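(* Let $N\ge2$, $\rho>0$, let $n_0$ and $M$ be non-negative integers, let $n_j=n_0+j$ for $j=0,\ldots,N-1$, and suppose $n_{N-1}<M$. Let $c_0,\ldots,c_{N-1}>0$, let $$\mathcal{C}:=\sum_{j=0}^{N-1}\frac{V(\mathbf{n}_j)^2}{V(\mathbf{n})^2}\frac{\rho^{M-n_j}}{c_j},\qquad \mathbf{n}:=(n_0,\ldots,n_{N-1}),\quad \mathbf{n}_j:=(n_0,\ldots,\widehat{n_j},\ldots,n_{N-1},M),$$ let $c'>-\mathcal{C}^{-1}$ be real, and set $$h(z)=\sum_{j=0}^{N-1}c_jz^{n_j},\qquad f(z)=h(z)+c'z^M,\qquad g(z)=h(z)-\mathcal{C}^{-1}z^M.$$ Let $A\in\mathcal{P}_N(\overline{D}(0,\rho))$, with $n_0=0$ if $A$ has a zero row. Then $$\operatorname{rank}f[A]=\operatorname{rank}h[A]=|\pi(A)|,$$ while $\operatorname{rank}g[A]=|\pi(A)|$ if (a) $A\notin\mathcal{S}_{\pi_\vee}$, or (b) $A\in\mathcal{S}_{\pi_\vee}$ and $A$ has a row with distinct entries, with $n_0=0$ if any entry in this row is zero.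
   Context: $\mathcal{P}_N(\overline{D}(0,\rho))$ is the set of positive semidefinite (hence Hermitian) $N\times N$ matrices with entries in the closed disc $\overline{D}(0,\rho)\subseteq\mathbb{C}$ of center $0$ and radius $\rho$. $f[A]:=(f(a_{ij}))$ is the entrywise action, with $0^0:=1$. In $\mathbf{n}_j$, $\widehat{n_j}$ indicates that $n_j$ is omitted. For $\mathbf{m}=(m_1,\ldots,m_N)$, $V(\mathbf{m}):=\prod_{1\le k<l\le N}(m_l-m_k)$. $(\Pi_N,\preccurlyeq)$ is the poset of partitions of $\{1,\ldots,N\}$, with $\pi'\preccurlyeq\pi$ if and only if $\pi$ is a refinement of $\pi'$ (every set in $\pi$ is a subset of some set in $\pi'$); $|\pi|$ is the number of sets in $\pi$. For a complex $N\times N$ matrix $A$, $\pi(A)$ is the unique minimal (that is, coarsest) partition $\pi\in\Pi_N$ such that, for all $I,J\in\pi$, the submatrix $A_{I\times J}$ (rows in $I$, columns in $J$) has all its entries equal. The stratum of $\pi\in\Pi_N$ is $\mathcal{S}_\pi:=\{A\in\mathbb{C}^{N\times N}:\pi(A)=\pi\}$. $\pi_\vee:=\{\{1\},\ldots,\{N\}\}$. *)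

theory Defs
  imports
    Complex_Main
    "HOL-Library.Disjoint_Sets"
    "Jordan_Normal_Form.Matrix"
    "Jordan_Normal_Form.DL_Rank"
begin

text \<open>Matrices are indexed from 0, so the index set \<open>{1, \<dots>, N}\<close> is rendered as \<open>{0..<N}\<close>.\<close>

text \<open>The order on the complex numbers is that of \<open>HOL-Library.Complex_Order\<close>: \<open>0 \<le> z\<close> says that
  \<open>z\<close> is real and non-negative. Over the complex numbers, this forces the matrix to be Hermitian.\<close>

definition psd :: "nat \<Rightarrow> complex mat \<Rightarrow> bool" where
  "psd N A \<longleftrightarrow> A \<in> carrier_mat N N \<and> (\<forall>v \<in> carrier_vec N. (A *\<^sub>v v) \<bullet>c v \<ge> 0)"

definition psd_disc :: "nat \<Rightarrow> real \<Rightarrow> complex mat set" where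
  "psd_disc N \<rho> = {A. psd N A \<and> (\<forall>i<N. \<forall>j<N. cmod (A $$ (i, j)) \<le> \<rho>)}"

definition entrywise :: "(complex \<Rightarrow> complex) \<Rightarrow> complex mat \<Rightarrow> complex mat" where
  "entrywise f A = map_mat f A"

definition vdm :: "nat list \<Rightarrow> real" where
  "vdm m = (\<Prod>l<length m. \<Prod>k<l. real (m ! l) - real (m ! k))"

definition exps :: "nat \<Rightarrow> (nat \<Rightarrow> nat) \<Rightarrow> nat list" where
  "exps N n = map n [0..<N]"

definition exps_omit :: "nat \<Rightarrow> (nat \<Rightarrow> nat) \<Rightarrow> nat \<Rightarrow> nat \<Rightarrow> nat list" where
  "exps_omit N n M j = map n ([0..<j] @ [Suc j..<N]) @ [M]"

definition crit_const :: "nat \<Rightarrow> real \<Rightarrow> (nat \<Rightarrow> nat) \<Rightarrow> nat \<Rightarrow> (nat \<Rightarrow> real) \<Rightarrow> real" where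
  "crit_const N \<rho> n M c =
     (\<Sum>j<N. (vdm (exps_omit N n M j))\<^sup>2 / (vdm (exps N n))\<^sup>2 * (\<rho> ^ (M - n j) / c j))"

text \<open>\<open>coarser N p' p\<close> is the order \<open>p' \<preceq> p\<close> on the partitions of the index set. Note that
  \<^const>\<open>refines\<close> takes the finer partition first.\<close>

definition coarser :: "nat \<Rightarrow> nat set set \<Rightarrow> nat set set \<Rightarrow> bool" where
  "coarser N p' p \<longleftrightarrow> refines {0..<N} p p'"

definition block_constant :: "nat \<Rightarrow> complex mat \<Rightarrow> nat set set \<Rightarrow> bool" where
  "block_constant N A p \<longleftrightarrow> partition_on {0..<N} p \<and>
     (\<forall>I\<in>p. \<forall>J\<in>p. \<forall>i\<in>I. \<forall>i'\<in>I. \<forall>j\<in>J. \<forall>j'\<in>J. A $$ (i, j) = A $$ (i', j'))"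

definition block_partition :: "nat \<Rightarrow> complex mat \<Rightarrow> nat set set" where
  "block_partition N A =
     (THE p. block_constant N A p \<and> (\<forall>q. block_constant N A q \<and> coarser N q p \<longrightarrow> q = p))"

definition stratum :: "nat \<Rightarrow> nat set set \<Rightarrow> complex mat set" where
  "stratum N p = {A \<in> carrier_mat N N. block_partition N A = p}"

definition finest :: "nat \<Rightarrow> nat set set" where
  "finest N = (\<lambda>i. {i}) ` {0..<N}"

text \<open>The definite description is legitimate: there is a least block-constant partition, hence
  exactly one minimal one.\<close>

lemma least_block_constant:
  "\<exists>p. block_constant N A p \<and> (\<forall>q. block_constant N A q \<longrightarrow> coarser N p q)"
proof -
  define R where "R = {(i, i'). i < N \<and> i' < N \<and>
    (\<forall>j<N. A $$ (i, j) = A $$ (i', j) \<and> A $$ (j, i) = A $$ (j, i'))}"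
  have eq: "equiv {0..<N} R"
    by (rule equivI) (auto simp: R_def refl_on_def sym_def trans_def)
  define p where "p = {0..<N} // R"
  have part: "partition_on {0..<N} p"
    unfolding p_def by (rule partition_on_quotient[OF eq])
  have rel: "(i, i') \<in> R" if "I \<in> p" "i \<in> I" "i' \<in> I" for I i i'
    using that eq unfolding p_def by (meson in_quotient_imp_in_rel empty_subsetI insert_subset)
  have "block_constant N A p"
    unfolding block_constant_def
  proof (intro conjI ballI part)
    fix I J i i' j j' assume "I \<in> p" "J \<in> p" "i \<in> I" "i' \<in> I" "j \<in> J" "j' \<in> J"
    then have "(i, i') \<in> R" "(j, j') \<in> R" using rel by blast+
    then show "A $$ (i, j) = A $$ (i', j')" unfolding R_def by auto
  qed
  moreover have "coarser N p q" if q: "block_constant N A q" for q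
    unfolding coarser_def refines_def
  proof (intro conjI ballI part)
    show pq: "partition_on {0..<N} q" using q by (simp add: block_constant_def)
    fix X assume X: "X \<in> q"
    then obtain x where x: "x \<in> X" using pq by (metis partition_on_def ex_in_conv)
    have "(x, y) \<in> R" if y: "y \<in> X" for y
    proof -
      have cover: "\<Union> q = {0..<N}" using pq by (simp add: partition_on_def)
      have "x < N" "y < N" using x y X cover by auto
      moreover have "A $$ (x, j) = A $$ (y, j) \<and> A $$ (j, x) = A $$ (j, y)" if "j < N" for j
      proof -
        from that cover obtain J where "J \<in> q" "j \<in> J" by (metis UnionE atLeastLessThan_iff zero_le)
        then show ?thesis using q X x y unfolding block_constant_def by blast
      qed
      ultimately show ?thesis unfolding R_def by auto
    qed
    then have "X \<subseteq> R `` {x}" by auto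
    moreover have "R `` {x} \<in> p"
      using x X pq unfolding p_def partition_on_def by (auto intro: quotientI)
    ultimately show "\<exists>Y\<in>p. X \<subseteq> Y" by blast
  qed
  ultimately show ?thesis by blast
qed

lemma block_partition_least:
  "block_constant N A (block_partition N A)"
  "block_constant N A q \<Longrightarrow> coarser N (block_partition N A) q"
proof -
  obtain p where p: "block_constant N A p" "\<And>q. block_constant N A q \<Longrightarrow> coarser N p q"
    using least_block_constant by blast
  have "block_partition N A = p"
    unfolding block_partition_def
  proof (rule the_equality)
    show "block_constant N A p \<and> (\<forall>q. block_constant N A q \<and> coarser N q p \<longrightarrow> q = p)"
      using p refines_asym unfolding coarser_def by blast
  qed (use p in blast)
  then show "block_constant N A (block_partition N A)"
    "block_constant N A q \<Longrightarrow> coarser N (block_partition N A) q"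
    using p by auto
qed

end

theory Submission
  imports Defs "HOL-Analysis.L2_Norm" "HOL-Computational_Algebra.Polynomial"
begin

text \<open>
  The three functions have the form \<open>h(z) + t z\<^sup>M\<close> with \<open>t \<ge> - 1 / C\<close>, where \<open>C\<close> is the critical
  constant: \<open>t = c'\<close> for \<open>f\<close>, \<open>t = 0\<close> for \<open>h\<close> and \<open>t = - 1 / C\<close> for \<open>g\<close>. For such a function the
  rank of the image of \<open>A\<close> is the number of blocks of \<open>A\<close> (\<open>rank_entrywise_eq_card_blocks\<close>).
  Indices in one block give equal columns, so it is enough to choose one index from each block,
  to restrict \<open>A\<close> to these indices, and to show that the image of the restricted matrix \<open>a\<close> is
  positive definite. The rows of \<open>a\<close> are pairwise distinct.

  First, \<open>h[a]\<close> is positive definite (\<open>power_sum_definite\<close>). For a generic vector \<open>w\<close> the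
  entries of \<open>a w\<close> are distinct, and \<open>a\<close> dominates a rank-one matrix \<open>\<zeta> \<zeta>\<^sup>*\<close> with \<open>\<zeta>\<close>
  proportional to \<open>a w\<close>; if \<open>n\<^sub>0 > 0\<close>, no row is zero, and the entries of \<open>\<zeta>\<close> are also non-zero.
  By the Schur product theorem the same domination holds for entrywise powers, and a vector that
  is annihilated by enough powers of \<open>\<zeta>\<close> is zero because Vandermonde matrices are invertible.

  Second, the term \<open>t z\<^sup>M\<close> cannot destroy this (\<open>perturbed_definite\<close>), because \<open>a\<^sup>M \<le> K h[a]\<close> in
  the Loewner order for some \<open>K < C\<close> (\<open>gap_psd_below_crit\<close>, for exponents that start at 0; the
  Schur product with an entrywise power covers the others). For \<open>a = \<zeta> \<zeta>\<^sup>*\<close> this is the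
  Cauchy--Schwarz inequality applied to the remainder of \<open>x\<^sup>M\<close> modulo \<open>\<Prod>\<^sub>i (x - \<zeta>\<^sub>i)\<close>
  (\<open>gap_rank1\<close>). The coefficients of this remainder are, up to sign, Schur polynomials of hooks;
  they have non-negative coefficients, so that on the disc of radius \<open>\<surd>\<rho>\<close> they are largest when
  all nodes are equal to \<open>\<surd>\<rho>\<close>, and the value there produces \<open>C\<close>. The bound is strict as soon as
  there are fewer than \<open>N\<close> nodes or two of them differ, and one of the two is the case for
  \<open>N \<ge> 2\<close> and distinct rows, if the rank-one matrix below is chosen well. The general case is an
  induction on the dimension in the manner of FitzGerald and Horn (\<open>gap_increment\<close>): one splits
  off a rank-one matrix that agrees with \<open>a\<close> in one row and column, and follows the entrywise
  image along the segment from it to \<open>a\<close>. The derivative is a function of the same kind with one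
  exponent less, needed only in one dimension less, and by \<open>crit_derivative\<close> even a constant
  smaller than \<open>C\<close> would do for it.
\<close>

section \<open>Positive semidefinite forms on a finite index set\<close>

definition qform :: "nat set \<Rightarrow> (nat \<Rightarrow> nat \<Rightarrow> complex) \<Rightarrow> (nat \<Rightarrow> complex) \<Rightarrow> complex" where
  "qform S a v = (\<Sum>i\<in>S. \<Sum>j\<in>S. cnj (v i) * a i j * v j)"

definition hermitian_on :: "nat set \<Rightarrow> (nat \<Rightarrow> nat \<Rightarrow> complex) \<Rightarrow> bool" where
  "hermitian_on S a \<longleftrightarrow> (\<forall>i\<in>S. \<forall>j\<in>S. a j i = cnj (a i j))"

definition psd_on :: "nat set \<Rightarrow> (nat \<Rightarrow> nat \<Rightarrow> complex) \<Rightarrow> bool" where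
  "psd_on S a \<longleftrightarrow> hermitian_on S a \<and> (\<forall>v. 0 \<le> Re (qform S a v))"

lemma psd_onD: "psd_on S a \<Longrightarrow> 0 \<le> Re (qform S a v)"
  by (simp add: psd_on_def)

lemma psd_on_hermitian: "psd_on S a \<Longrightarrow> i \<in> S \<Longrightarrow> j \<in> S \<Longrightarrow> a j i = cnj (a i j)"
  unfolding psd_on_def hermitian_on_def by blast

lemma psd_onI:
  assumes "\<And>i j. i \<in> S \<Longrightarrow> j \<in> S \<Longrightarrow> a j i = cnj (a i j)" "\<And>v. 0 \<le> Re (qform S a v)"
  shows "psd_on S a"
  using assms unfolding psd_on_def hermitian_on_def by blast

lemma qform_cong:
  assumes "\<And>i j. i \<in> S \<Longrightarrow> j \<in> S \<Longrightarrow> a i j = b i j" "\<And>i. i \<in> S \<Longrightarrow> v i = w i"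
  shows "qform S a v = qform S b w"
  unfolding qform_def by (intro sum.cong) (auto simp: assms)

lemma psd_on_cong:
  assumes "psd_on S a" "\<And>i j. i \<in> S \<Longrightarrow> j \<in> S \<Longrightarrow> a i j = b i j"
  shows "psd_on S b"
proof (rule psd_onI)
  show "b j i = cnj (b i j)" if "i \<in> S" "j \<in> S" for i j
    using psd_on_hermitian[OF assms(1) that] assms(2) that by metis
  show "0 \<le> Re (qform S b v)" for v
    using psd_onD[OF assms(1)] qform_cong[of S a b] assms(2) by metis
qed

lemma qform_add: "qform S (\<lambda>i j. a i j + b i j) v = qform S a v + qform S b v"
  unfolding qform_def by (simp add: algebra_simps sum.distrib)

lemma qform_diff: "qform S (\<lambda>i j. a i j - b i j) v = qform S a v - qform S b v"
  unfolding qform_def by (simp add: algebra_simps sum_subtractf)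

lemma qform_scale: "qform S (\<lambda>i j. c * a i j) v = c * qform S a v"
  unfolding qform_def sum_distrib_left by (simp add: algebra_simps)

lemma qform_sum: "qform S (\<lambda>i j. \<Sum>l\<in>L. a l i j) v = (\<Sum>l\<in>L. qform S (a l) v)"
proof (induction L rule: infinite_finite_induct)
  case (insert x F)
  then show ?case by (simp add: qform_add)
qed (simp_all add: qform_def)

lemma qform_rank1:
  "qform S (\<lambda>i j. z i * cnj (z j)) v = of_real ((cmod (\<Sum>i\<in>S. cnj (v i) * z i))\<^sup>2)"
  unfolding qform_def complex_norm_square cnj_sum sum_product
  by (intro sum.cong) (auto simp: algebra_simps)

lemma psd_on_add:
  assumes "psd_on S a" "psd_on S b"
  shows "psd_on S (\<lambda>i j. a i j + b i j)"
proof (rule psd_onI)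
  show "a j i + b j i = cnj (a i j + b i j)" if "i \<in> S" "j \<in> S" for i j
    using psd_on_hermitian[OF assms(1) that] psd_on_hermitian[OF assms(2) that] by simp
qed (use assms in \<open>simp add: qform_add psd_onD\<close>)

lemma psd_on_scale:
  assumes "0 \<le> r" "psd_on S a"
  shows "psd_on S (\<lambda>i j. of_real r * a i j)"
proof (rule psd_onI)
  show "of_real r * a j i = cnj (of_real r * a i j)" if "i \<in> S" "j \<in> S" for i j
    using psd_on_hermitian[OF assms(2) that] by simp
qed (use assms in \<open>simp add: qform_scale psd_onD\<close>)

lemma psd_on_sum:
  assumes "\<And>l. l \<in> L \<Longrightarrow> psd_on S (a l)"
  shows "psd_on S (\<lambda>i j. \<Sum>l\<in>L. a l i j)"
proof (rule psd_onI)
  show "(\<Sum>l\<in>L. a l j i) = cnj (\<Sum>l\<in>L. a l i j)" if "i \<in> S" "j \<in> S" for i j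
    unfolding cnj_sum using psd_on_hermitian[OF assms that] by (intro sum.cong) auto
qed (use assms in \<open>simp add: qform_sum psd_onD sum_nonneg\<close>)

lemma psd_on_rank1: "psd_on S (\<lambda>i j. z i * cnj (z j))"
  by (rule psd_onI) (simp_all add: qform_rank1)

lemma qform_restrict:
  assumes "finite S" "T \<subseteq> S"
  shows "qform S a (\<lambda>i. if i \<in> T then v i else 0) = qform T a v"
proof -
  have "qform T a v = (\<Sum>i\<in>T. \<Sum>j\<in>S. cnj (v i) * a i j * (if j \<in> T then v j else 0))"
    unfolding qform_def using assms
    by (intro sum.cong refl sum.mono_neutral_cong_left) auto
  also have "\<dots> = qform S a (\<lambda>i. if i \<in> T then v i else 0)"
    unfolding qform_def using assms
    by (intro sum.mono_neutral_cong_left) auto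
  finally show ?thesis by simp
qed

lemma psd_on_subset:
  assumes "psd_on S a" "finite S" "T \<subseteq> S"
  shows "psd_on T a"
proof (rule psd_onI)
  show "a j i = cnj (a i j)" if "i \<in> T" "j \<in> T" for i j
    using psd_on_hermitian[OF assms(1)] that assms(3) by blast
  show "0 \<le> Re (qform T a v)" for v
    using psd_onD[OF assms(1)] qform_restrict[OF assms(2,3)] by metis
qed

text \<open>A zero row and column contribute nothing to the form. This is how positivity on a smaller
  index set is carried back after a row has been cleared.\<close>

lemma psd_on_extend_zero:
  assumes "psd_on (S - {p}) a" "finite S"
    and "\<And>i. i \<in> S \<Longrightarrow> a i p = 0" "\<And>i. i \<in> S \<Longrightarrow> a p i = 0"
  shows "psd_on S a"
proof (rule psd_onI)
  show "a j i = cnj (a i j)" if "i \<in> S" "j \<in> S" for i j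
    using psd_on_hermitian[OF assms(1), of i j] that assms(3,4)
    by (cases "i = p"; cases "j = p") auto
  fix v
  have "qform (S - {p}) a v = (\<Sum>i\<in>S-{p}. \<Sum>j\<in>S. cnj (v i) * a i j * v j)"
    unfolding qform_def using assms
    by (intro sum.cong refl sum.mono_neutral_cong_left) auto
  also have "\<dots> = qform S a v"
    unfolding qform_def using assms
    by (intro sum.mono_neutral_cong_left) auto
  finally show "0 \<le> Re (qform S a v)" using psd_onD[OF assms(1), of v] by simp
qed

lemma nonneg_quadratic_linear_zero:
  fixes q y :: real
  assumes "\<And>s. 0 \<le> q - 2 * s * y" "0 \<le> y"
  shows "y = 0"
proof (rule ccontr)
  assume "y \<noteq> 0"
  then have "y > 0" using assms by simp
  then show False using assms(1)[of "(\<bar>q\<bar> + 1) / y"] by (simp add: abs_if split: if_splits)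
qed

lemma cnj_mult_self: "cnj z * z = of_real ((cmod z)\<^sup>2)"
  unfolding complex_norm_square by (rule mult.commute)

lemma Re_of_real_mult: "Re (of_real r * z) = r * Re z"
  by simp

text \<open>Completing the square in the direction \<open>w\<close>. Positivity at \<open>v + t w\<close> for every complex \<open>t\<close>
  gives the Cauchy--Schwarz inequality \<open>|w\<^sup>* a v|\<^sup>2 \<le> (w\<^sup>* a w) (v\<^sup>* a v)\<close>, that is, the
  positivity of \<open>a - \<zeta> \<zeta>\<^sup>*\<close>. If \<open>w\<^sup>* a w = 0\<close>, then \<open>a w = 0\<close> and \<open>\<zeta> = 0\<close> by the convention
  \<open>z / 0 = 0\<close>. For a unit vector \<open>w\<close> this clears a row (\<open>peel\<close>); for a generic \<open>w\<close> it bounds \<open>a\<close>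
  from below by a rank-one matrix \<open>\<zeta> \<zeta>\<^sup>*\<close> in which \<open>\<zeta>\<close> has distinct entries
  (\<open>power_sum_definite\<close>).\<close>

lemma schur_complement:
  fixes a :: "nat \<Rightarrow> nat \<Rightarrow> complex" and w :: "nat \<Rightarrow> complex"
  assumes fin: "finite S" and psd: "psd_on S a"
  defines "x \<equiv> \<lambda>i. \<Sum>j\<in>S. a i j * w j"
  defines "\<kappa> \<equiv> sqrt (Re (qform S a w))"
  defines "\<zeta> \<equiv> \<lambda>i. x i / of_real \<kappa>"
  shows "psd_on S (\<lambda>i j. a i j - \<zeta> i * cnj (\<zeta> j))"
    and "\<And>i. i \<in> S \<Longrightarrow> x i = of_real \<kappa> * \<zeta> i"
proof -
  define \<beta> where "\<beta> = Re (qform S a w)"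
  have \<beta>0: "0 \<le> \<beta>" unfolding \<beta>_def using psd by (rule psd_onD)
  have \<kappa>2: "\<kappa>\<^sup>2 = \<beta>" "0 \<le> \<kappa>" using \<beta>0 unfolding \<kappa>_def \<beta>_def by auto
  have herm: "a j i = cnj (a i j)" if "i \<in> S" "j \<in> S" for i j
    using psd_on_hermitian[OF psd] that by blast
  define y where "y v = (\<Sum>i\<in>S. cnj (v i) * x i)" for v
  have expand: "0 \<le> Re (qform S a v) + 2 * Re (t * y v) + (cmod t)\<^sup>2 * \<beta>" for v t
  proof -
    have 1: "y v = (\<Sum>i\<in>S. \<Sum>j\<in>S. cnj (v i) * a i j * w j)"
      unfolding y_def x_def by (simp add: sum_distrib_left algebra_simps)
    have 2: "cnj (y v) = (\<Sum>i\<in>S. \<Sum>j\<in>S. cnj (w i) * a i j * v j)"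
      unfolding 1 cnj_sum
      by (subst sum.swap, intro sum.cong refl) (simp add: algebra_simps flip: herm)
    have "qform S a (\<lambda>i. v i + t * w i)
        = qform S a v + t * y v + cnj t * cnj (y v) + (cnj t * t) * qform S a w"
      unfolding 2 unfolding 1 qform_def
      by (simp add: algebra_simps sum.distrib sum_distrib_left)
    moreover have "Re (cnj t * t * qform S a w) = (cmod t)\<^sup>2 * \<beta>"
      unfolding \<beta>_def cnj_mult_self by (rule Re_of_real_mult)
    moreover have "Re (cnj t * cnj (y v)) = Re (t * y v)" by simp
    ultimately show ?thesis using psd_onD[OF psd, of "\<lambda>i. v i + t * w i"] by simp
  qed
  have null: "y v = 0" if "\<beta> = 0" for v
  proof -
    \<comment> \<open>Otherwise a large multiple of \<open>- cnj (y v)\<close>, taken for \<open>t\<close>, violates positivity.\<close>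
    have "(cmod (y v))\<^sup>2 = 0"
    proof (rule nonneg_quadratic_linear_zero[of "Re (qform S a v)"])
      fix s :: real
      have "Re (- of_real s * cnj (y v) * y v) = - s * (cmod (y v))\<^sup>2"
        unfolding mult.assoc cnj_mult_self by (simp add: power2_eq_square)
      then show "0 \<le> Re (qform S a v) - 2 * s * (cmod (y v))\<^sup>2"
        using expand[of v "- of_real s * cnj (y v)"] that by simp
    qed simp
    then show ?thesis by simp
  qed
  show xz: "x i = of_real \<kappa> * \<zeta> i" if "i \<in> S" for i
  proof (cases "\<kappa> = 0")
    case True
    then have "y (\<lambda>j. if j = i then 1 else 0) = 0" using null \<kappa>2 by auto
    then have "x i = 0" using that fin unfolding y_def
      by (simp add: if_distrib[of cnj] if_distrib[of "\<lambda>c. c * _"] sum.delta cong: if_cong)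
    then show ?thesis using True by simp
  next
    case False
    then show ?thesis unfolding \<zeta>_def by simp
  qed
  show "psd_on S (\<lambda>i j. a i j - \<zeta> i * cnj (\<zeta> j))"
  proof (rule psd_onI)
    show "a j i - \<zeta> j * cnj (\<zeta> i) = cnj (a i j - \<zeta> i * cnj (\<zeta> j))" if "i \<in> S" "j \<in> S" for i j
      using herm[OF that] by simp
    fix v
    have "(\<Sum>i\<in>S. cnj (v i) * \<zeta> i) = y v / of_real \<kappa>"
      unfolding y_def \<zeta>_def by (simp add: sum_divide_distrib)
    then have q: "Re (qform S (\<lambda>i j. a i j - \<zeta> i * cnj (\<zeta> j)) v) = Re (qform S a v) - (cmod (y v) / \<kappa>)\<^sup>2"
      using \<kappa>2 by (simp add: qform_diff qform_rank1 norm_divide)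
    show "0 \<le> Re (qform S (\<lambda>i j. a i j - \<zeta> i * cnj (\<zeta> j)) v)"
    proof (cases "\<beta> = 0")
      case True
      then show ?thesis unfolding q using null psd_onD[OF psd, of v] by simp
    next
      case False
      \<comment> \<open>The minimum over \<open>t\<close> is attained at \<open>t = - cnj (y v) / \<beta>\<close>.\<close>
      define m where "m = (cmod (y v))\<^sup>2"
      have a1: "Re (- cnj (y v) / of_real \<beta> * y v) = - m / \<beta>"
        unfolding m_def cmod_power2 by (simp add: power2_eq_square add_divide_distrib diff_divide_distrib)
      have a2: "(cmod (- cnj (y v) / of_real \<beta>))\<^sup>2 * \<beta> = m / \<beta>"
        unfolding m_def using False \<beta>0 by (simp add: norm_divide power_divide power2_eq_square)
      have a3: "(cmod (y v) / \<kappa>)\<^sup>2 = m / \<beta>" using \<kappa>2 by (simp add: m_def power_divide)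
      show ?thesis
        using expand[of v "- cnj (y v) / of_real \<beta>"] unfolding q a1 a2 a3 by linarith
    qed
  qed
qed

text \<open>Gaussian elimination of the row and column \<open>p\<close>: the remainder \<open>a - \<zeta> \<zeta>\<^sup>*\<close> is positive and
  lives on the other indices. All inductions on the dimension below rest on it.\<close>

lemma peel:
  assumes fin: "finite S" and psd: "psd_on S a" and p: "p \<in> S"
  obtains \<zeta> where "psd_on S (\<lambda>i j. a i j - \<zeta> i * cnj (\<zeta> j))"
    and "\<And>i. i \<in> S \<Longrightarrow> a i p = \<zeta> i * cnj (\<zeta> p)"
    and "\<And>i. i \<in> S \<Longrightarrow> a p i = \<zeta> p * cnj (\<zeta> i)"
proof -
  define w :: "nat \<Rightarrow> complex" where "w = (\<lambda>i. if i = p then 1 else 0)"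
  define \<kappa> where "\<kappa> = sqrt (Re (qform S a w))"
  have x: "(\<Sum>j\<in>S. a i j * w j) = a i p" for i
    unfolding w_def using p fin by (simp add: if_distrib[of "\<lambda>c. _ * c"] sum.delta cong: if_cong)
  have qw: "qform S a w = a p p"
    using p fin unfolding qform_def w_def
    by (simp add: if_distrib[of "\<lambda>c. _ * c"] if_distrib[of cnj] if_distrib[of "\<lambda>c. c * _"] sum.delta cong: if_cong)
  define \<zeta> where "\<zeta> = (\<lambda>i. a i p / of_real \<kappa>)"
  have 1: "psd_on S (\<lambda>i j. a i j - \<zeta> i * cnj (\<zeta> j))"
    using schur_complement(1)[OF fin psd, of w] unfolding x \<zeta>_def \<kappa>_def .
  have 2: "a i p = of_real \<kappa> * \<zeta> i" if "i \<in> S" for i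
    using schur_complement(2)[OF fin psd, of _ w] that unfolding x \<zeta>_def \<kappa>_def by blast
  have "cnj (a p p) = a p p" using psd_on_hermitian[OF psd p p] by simp
  then have "a p p = of_real (Re (a p p))" by (metis Reals_cnj_iff of_real_Re)
  moreover have "Re (a p p) = \<kappa>\<^sup>2"
    unfolding \<kappa>_def using psd_onD[OF psd, of w] by (simp add: qw)
  ultimately have "a p p = of_real (\<kappa>\<^sup>2)" by simp
  then have "\<zeta> p = of_real \<kappa>" unfolding \<zeta>_def by (simp add: power2_eq_square)
  then have 3: "a i p = \<zeta> i * cnj (\<zeta> p)" if "i \<in> S" for i
    using 2[OF that] by (simp add: mult.commute)
  have 4: "a p i = \<zeta> p * cnj (\<zeta> i)" if "i \<in> S" for i
    using 3[OF that] psd_on_hermitian[OF psd that p] by simp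
  show ?thesis using that 1 3 4 by blast
qed

section \<open>Entrywise products and powers\<close>

lemma psd_on_mult_rank1:
  assumes "psd_on S a"
  shows "psd_on S (\<lambda>i j. z i * cnj (z j) * a i j)"
proof (rule psd_onI)
  show "z j * cnj (z i) * a j i = cnj (z i * cnj (z j) * a i j)" if "i \<in> S" "j \<in> S" for i j
    using psd_on_hermitian[OF assms that] by simp
  fix v
  have "qform S (\<lambda>i j. z i * cnj (z j) * a i j) v = qform S a (\<lambda>i. cnj (z i) * v i)"
    unfolding qform_def by (intro sum.cong refl) (simp add: algebra_simps)
  then show "0 \<le> Re (qform S (\<lambda>i j. z i * cnj (z j) * a i j) v)"
    using psd_onD[OF assms] by simp
qed

text \<open>The Schur product theorem, by eliminating one index at a time: \<open>a = \<zeta> \<zeta>\<^sup>* + d\<close>, where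
  multiplying by \<open>\<zeta> \<zeta>\<^sup>*\<close> is a congruence by a diagonal matrix, and \<open>d\<close> vanishes on the row and
  column \<open>p\<close>.\<close>

lemma schur_product:
  assumes "finite S" "psd_on S a" "psd_on S b"
  shows "psd_on S (\<lambda>i j. a i j * b i j)"
  using assms
proof (induction S arbitrary: a b rule: finite_psubset_induct)
  case (psubset S)
  show ?case
  proof (cases "S = {}")
    case True
    then show ?thesis by (simp add: psd_on_def hermitian_on_def qform_def)
  next
    case False
    then obtain p where p: "p \<in> S" by blast
    obtain \<zeta> where z: "psd_on S (\<lambda>i j. a i j - \<zeta> i * cnj (\<zeta> j))"
      "\<And>i. i \<in> S \<Longrightarrow> a i p = \<zeta> i * cnj (\<zeta> p)" "\<And>i. i \<in> S \<Longrightarrow> a p i = \<zeta> p * cnj (\<zeta> i)"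
      by (rule peel[OF psubset.hyps psubset.prems(1) p]) (rule that)
    define d where "d = (\<lambda>i j. a i j - \<zeta> i * cnj (\<zeta> j))"
    have "psd_on (S - {p}) (\<lambda>i j. d i j * b i j)"
    proof (rule psubset.IH)
      show "S - {p} \<subset> S" using p by blast
      show "psd_on (S - {p}) d" "psd_on (S - {p}) b"
        using psd_on_subset[OF _ psubset.hyps(1)] z(1) psubset.prems(2) unfolding d_def by auto
    qed
    then have "psd_on S (\<lambda>i j. d i j * b i j)"
      by (rule psd_on_extend_zero) (use psubset.hyps z in \<open>auto simp: d_def\<close>)
    moreover have "psd_on S (\<lambda>i j. \<zeta> i * cnj (\<zeta> j) * b i j)"
      by (rule psd_on_mult_rank1) fact
    ultimately show ?thesis
      by (rule psd_on_cong[OF psd_on_add]) (simp add: d_def algebra_simps)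
  qed
qed

lemma psd_on_power:
  assumes "finite S" "psd_on S a"
  shows "psd_on S (\<lambda>i j. a i j ^ m)"
proof (induction m)
  case 0
  show ?case using psd_on_rank1[of S "\<lambda>_. 1"] by simp
next
  case (Suc m)
  show ?case using schur_product[OF assms Suc.IH] by simp
qed

text \<open>Telescoping: \<open>a\<^sup>m\<^sup>+\<^sup>1 - x\<^sup>m\<^sup>+\<^sup>1 = a\<^sup>m (a - x) + x (a\<^sup>m - x\<^sup>m)\<close> entrywise, where both products
  are positive by the Schur product theorem.\<close>

lemma power_dominates_rank1:
  assumes "finite S" "psd_on S a" "psd_on S (\<lambda>i j. a i j - z i * cnj (z j))"
  shows "psd_on S (\<lambda>i j. a i j ^ m - (z i * cnj (z j)) ^ m)"
proof (induction m)
  case 0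
  show ?case by (simp add: psd_on_def hermitian_on_def qform_def)
next
  case (Suc m)
  have "psd_on S (\<lambda>i j. a i j ^ m * (a i j - z i * cnj (z j)))"
    by (rule schur_product[OF assms(1) psd_on_power[OF assms(1,2)] assms(3)])
  moreover have "psd_on S (\<lambda>i j. z i * cnj (z j) * (a i j ^ m - (z i * cnj (z j)) ^ m))"
    by (rule psd_on_mult_rank1) (rule Suc.IH)
  ultimately show ?case
    by (rule psd_on_cong[OF psd_on_add]) (simp add: algebra_simps)
qed

section \<open>Interpolating a power, and hook Schur polynomials\<close>

text \<open>For \<open>d > 0\<close> and \<open>j < k\<close> this is the Schur polynomial of the hook \<open>(d, 1, \<dots>, 1)\<close> with
  \<open>k - 1 - j\<close> ones, in the variables \<open>u 0, \<dots>, u (k - 1)\<close>. The recursion comes from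
  \<open>x\<^sup>m\<^sup>+\<^sup>1 = u\<^sub>k x\<^sup>m + (x - u\<^sub>k) x\<^sup>m\<close>, reduced modulo the polynomial with roots \<open>u 0, \<dots>, u k\<close>.
  It has no subtractions, so that every coefficient is non-negative and, on a disc, the modulus
  is largest when all variables equal the radius.\<close>

fun hook :: "(nat \<Rightarrow> 'a::comm_ring_1) \<Rightarrow> nat \<Rightarrow> nat \<Rightarrow> nat \<Rightarrow> 'a" where
  "hook u 0 d j = 0"
| "hook u (Suc k) 0 j = (if j = k then 1 else 0)"
| "hook u (Suc k) (Suc d) 0 = u k * hook u (Suc k) d 0 + u k * hook u k (Suc d) 0"
| "hook u (Suc k) (Suc d) (Suc j) =
     u k * hook u (Suc k) d (Suc j) + u k * hook u k (Suc d) (Suc j) + hook u k (Suc d) j"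

lemma hook_eq_0: "k \<le> j \<Longrightarrow> hook u k d j = 0"
  by (induction u k d j rule: hook.induct) auto

text \<open>For \<open>k > 0\<close>, the remainder of \<open>x\<^bsup>k - 1 + d\<^esup>\<close> modulo the polynomial with roots
  \<open>u 0, \<dots>, u (k - 1)\<close>. The sign \<open>(-1)\<^bsup>k - 1 - j\<^esup>\<close> of the coefficient is written without
  subtraction.\<close>

definition hook_interpolant :: "(nat \<Rightarrow> 'a::comm_ring_1) \<Rightarrow> nat \<Rightarrow> nat \<Rightarrow> 'a \<Rightarrow> 'a" where
  "hook_interpolant u k d x = (\<Sum>j<k. (-1) ^ (Suc (k + j)) * hook u k d j * x ^ j)"

lemma hook_interpolant_Suc:
  "hook_interpolant u (Suc k) (Suc d) x =
     u k * hook_interpolant u (Suc k) d x + (x - u k) * hook_interpolant u k (Suc d) x"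
proof -
  define s :: "nat \<Rightarrow> 'a" where "s = (\<lambda>j. (-1) ^ (k + j))"
  have ext: "(\<Sum>j<Suc k. s j * hook u k (Suc d) j * x ^ j) = - hook_interpolant u k (Suc d) x"
    unfolding hook_interpolant_def s_def by (simp add: hook_eq_0 sum_negf)
  have 1: "(\<Sum>j<k. s (Suc j) * hook u k (Suc d) j * x ^ Suc j) = x * hook_interpolant u k (Suc d) x"
    unfolding hook_interpolant_def s_def sum_distrib_left
    by (intro sum.cong refl) (simp add: algebra_simps)
  have "hook_interpolant u (Suc k) (Suc d) x = (\<Sum>j<Suc k. s j * hook u (Suc k) (Suc d) j * x ^ j)"
    unfolding hook_interpolant_def s_def by simp
  also have "\<dots> = (\<Sum>j<Suc k. s j * (u k * hook u (Suc k) d j + u k * hook u k (Suc d) j) * x ^ j)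
      + (\<Sum>j<k. s (Suc j) * hook u k (Suc d) j * x ^ Suc j)"
    unfolding sum.lessThan_Suc_shift by (simp add: algebra_simps sum.distrib)
  also have "(\<Sum>j<Suc k. s j * (u k * hook u (Suc k) d j + u k * hook u k (Suc d) j) * x ^ j)
      = u k * (\<Sum>j<Suc k. s j * hook u (Suc k) d j * x ^ j)
        + u k * (\<Sum>j<Suc k. s j * hook u k (Suc d) j * x ^ j)"
    unfolding sum_distrib_left sum.distrib[symmetric]
    by (intro sum.cong refl) (simp add: algebra_simps)
  also have "(\<Sum>j<Suc k. s j * hook u (Suc k) d j * x ^ j) = hook_interpolant u (Suc k) d x"
    unfolding hook_interpolant_def s_def by simp
  finally show ?thesis unfolding ext 1 by (simp add: algebra_simps)
qed

text \<open>Both summands of the recursion are right at the nodes: at the last node the second one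
  vanishes, and at the others the induction hypothesis for fewer nodes applies.\<close>

lemma hook_interpolant_node:
  assumes "i \<le> k"
  shows "hook_interpolant u (Suc k) d (u i) = u i ^ (k + d)"
  using assms
proof (induction k arbitrary: d i)
  case 0
  have "hook u (Suc 0) d 0 = u 0 ^ d" for d by (induction d) auto
  then show ?case using 0 by (simp add: hook_interpolant_def)
next
  case outer: (Suc k)
  show ?case
  proof (induction d)
    case 0
    have "hook_interpolant u (Suc (Suc k)) 0 (u i)
        = (\<Sum>j<Suc (Suc k). if j = Suc k then u i ^ j else 0)"
      unfolding hook_interpolant_def
      by (intro sum.cong refl) (auto simp: minus_one_power_iff)
    then show ?case by simp
  next
    case (Suc d)
    have "(u i - u (Suc k)) * hook_interpolant u (Suc k) (Suc d) (u i)
        = (u i - u (Suc k)) * u i ^ (k + Suc d)"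
      using outer.prems outer.IH[of i "Suc d"] by (cases "i = Suc k") auto
    then show ?case unfolding hook_interpolant_Suc Suc.IH by (simp add: algebra_simps)
  qed
qed

lemma hook_norm_le:
  fixes u :: "nat \<Rightarrow> complex"
  assumes "0 \<le> r" "\<And>i. i < k \<Longrightarrow> cmod (u i) \<le> r"
  shows "cmod (hook u k d j) \<le> hook (\<lambda>_. r) k d j"
  using assms(2)
proof (induction u k d j rule: hook.induct)
  case (3 u k d)
  show ?case using 3 assms(1)
    by (auto intro!: norm_triangle_mono mult_mono simp: norm_mult)
next
  case (4 u k d j)
  show ?case using 4 assms(1)
    by (auto intro!: norm_triangle_mono mult_mono simp: norm_mult)
qed auto

text \<open>For \<open>j < N \<le> M\<close>, the value at \<open>(1, \<dots>, 1)\<close> of the hook polynomial in \<open>N\<close> variables with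
  \<open>d = M - N + 1\<close>. By the lemma \<open>vdm_ratio\<close> below it is also the quotient of Vandermonde
  products in the critical constant.\<close>

definition hook_dim :: "nat \<Rightarrow> nat \<Rightarrow> nat \<Rightarrow> real" where
  "hook_dim N M j = real (M choose j) * real ((M - 1 - j) choose (N - 1 - j))"

text \<open>The closed form satisfies the recursion of the polynomials by two applications of Pascal's
  rule.\<close>

lemma hook_const:
  assumes "j \<le> k"
  shows "hook (\<lambda>_. r::real) (Suc k) d j = hook_dim (Suc k) (k + d) j * r ^ (k + d - j)"
  using assms
proof (induction k arbitrary: d j)
  case 0
  have "hook (\<lambda>_. r) (Suc 0) d 0 = r ^ d" for d by (induction d) auto
  then show ?case using 0 by (simp add: hook_dim_def)
next
  case outer: (Suc k)
  show ?case using outer.prems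
  proof (induction d arbitrary: j)
    case 0
    then show ?case by (auto simp: hook_dim_def)
  next
    case (Suc d)
    show ?case
    proof (cases j)
      case 0
      have "hook (\<lambda>_. r) (Suc k) (Suc d) 0 = real (k + d choose k) * r ^ (k + Suc d)"
        using outer.IH[of 0 "Suc d"] by (simp add: hook_dim_def)
      moreover have "hook (\<lambda>_. r) (Suc (Suc k)) d 0 = real (k + d choose Suc k) * r ^ (Suc k + d)"
        using Suc.IH[of 0] by (simp add: hook_dim_def)
      ultimately show ?thesis unfolding 0 by (simp add: hook_dim_def algebra_simps)
    next
      case (Suc i)
      show ?thesis
      proof (cases "i = k")
        case True
        have "hook (\<lambda>_. r) (Suc k) (Suc d) k = real (k + Suc d choose k) * r ^ Suc d"
          using outer.IH[of k "Suc d"] by (simp add: hook_dim_def)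
        moreover have "hook (\<lambda>_. r) (Suc (Suc k)) d (Suc k) = real (Suc k + d choose Suc k) * r ^ d"
          using Suc.IH[of "Suc k"] by (simp add: hook_dim_def)
        ultimately show ?thesis unfolding Suc True by (simp add: hook_dim_def hook_eq_0 algebra_simps)
      next
        case False
        then obtain m where k: "k = Suc (i + m)"
          using Suc Suc.prems by (metis Suc_le_mono le_neq_implies_less less_iff_Suc_add)
        have "hook (\<lambda>_. r) (Suc k) (Suc d) i
            = real (k + Suc d choose i) * real (Suc m + d choose Suc m) * r ^ (Suc (Suc (m + d)))"
          using outer.IH[of i "Suc d"] by (simp add: hook_dim_def k)
        moreover have "hook (\<lambda>_. r) (Suc k) (Suc d) (Suc i)
            = real (k + Suc d choose Suc i) * real (m + d choose m) * r ^ (Suc (m + d))"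
          using outer.IH[of "Suc i" "Suc d"] by (simp add: hook_dim_def k)
        moreover have "hook (\<lambda>_. r) (Suc (Suc k)) d (Suc i)
            = real (Suc k + d choose Suc i) * real (m + d choose Suc m) * r ^ (Suc (m + d))"
          using Suc.IH[of "Suc i"] by (simp add: hook_dim_def k)
        ultimately have "hook (\<lambda>_. r) (Suc (Suc k)) (Suc d) (Suc i)
            = (real (Suc k + d choose i) + real (Suc k + d choose Suc i))
              * real (Suc m + d choose Suc m) * r ^ (Suc (Suc (m + d)))"
          by (simp add: algebra_simps)
        then show ?thesis unfolding Suc by (simp add: hook_dim_def k algebra_simps)
      qed
    qed
  qed
qed

lemma hook_top_1: "hook u (Suc k) 1 k = (\<Sum>i\<le>k. u i)"
  by (induction k) (auto simp: hook_eq_0)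

text \<open>The coefficient of the top power is a complete homogeneous polynomial. In degree 1 it is the
  sum of the nodes, and a strict inequality there propagates to all higher degrees through the
  recursion.\<close>

lemma hook_top_less:
  fixes u :: "nat \<Rightarrow> complex"
  assumes r: "0 < r" "\<And>i. i \<le> k \<Longrightarrow> cmod (u i) \<le> r"
    and small: "cmod (\<Sum>i\<le>k. u i) < real (Suc k) * r"
  shows "cmod (hook u (Suc k) (Suc d) k) < hook (\<lambda>_. r) (Suc k) (Suc d) k"
proof (induction d)
  case 0
  show ?case using small hook_top_1[of u k] hook_top_1[of "\<lambda>_. r" k] by simp
next
  case (Suc d)
  have uk: "cmod (u k * hook u (Suc k) (Suc d) k) < r * hook (\<lambda>_. r) (Suc k) (Suc d) k"
  proof (cases "u k = 0")
    case True
    then show ?thesis using le_less_trans[OF norm_ge_zero Suc.IH] r(1) by simp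
  next
    case False
    then show ?thesis unfolding norm_mult
      by (intro mult_le_less_imp_less) (use Suc.IH r in auto)
  qed
  show ?case
  proof (cases k)
    case 0
    then show ?thesis using uk by simp
  next
    case (Suc k')
    have "cmod (hook u k (Suc (Suc d)) k') \<le> hook (\<lambda>_. r) k (Suc (Suc d)) k'"
      using r by (intro hook_norm_le) auto
    moreover have "hook u (Suc k) (Suc (Suc d)) k
        = u k * hook u (Suc k) (Suc d) k + hook u k (Suc (Suc d)) k'"
      by (simp add: Suc hook_eq_0)
    moreover have "hook (\<lambda>_. r) (Suc k) (Suc (Suc d)) k
        = r * hook (\<lambda>_. r) (Suc k) (Suc d) k + hook (\<lambda>_. r) k (Suc (Suc d)) k'"
      by (simp add: Suc hook_eq_0)
    ultimately show ?thesis using uk by (metis add_less_le_mono norm_triangle_lt)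
  qed
qed

section \<open>The critical constant and matrices of rank one\<close>

text \<open>Positivity of \<open>gap K N M c\<close> at \<open>a\<close> says that the entrywise power \<open>a\<^sup>M\<close> is at most \<open>K h[a]\<close> in
  the Loewner order, where \<open>h(z) = \<Sum>\<^sub>l c\<^sub>l z\<^sup>l\<close> has the exponents \<open>0, \<dots>, N - 1\<close>.\<close>

definition gap :: "real \<Rightarrow> nat \<Rightarrow> nat \<Rightarrow> (nat \<Rightarrow> real) \<Rightarrow> complex \<Rightarrow> complex" where
  "gap K N M c z = of_real K * (\<Sum>l<N. of_real (c l) * z ^ l) - z ^ M"

text \<open>The constant \<^const>\<open>crit_const\<close> for the exponents \<open>0, \<dots>, N - 1\<close> and \<open>M\<close>, with the Vandermonde
  quotients evaluated.\<close>

definition crit :: "real \<Rightarrow> nat \<Rightarrow> nat \<Rightarrow> (nat \<Rightarrow> real) \<Rightarrow> real" where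
  "crit \<rho> N M c = (\<Sum>j<N. (hook_dim N M j)\<^sup>2 * (\<rho> ^ (M - j) / c j))"

lemma psd_on_diag:
  assumes "psd_on S a" "finite S" "i \<in> S"
  shows "0 \<le> Re (a i i)"
proof -
  have "psd_on {i} a" using psd_on_subset[OF assms(1,2), of "{i}"] assms(3) by simp
  from psd_onD[OF this, of "\<lambda>_. 1"] show ?thesis by (simp add: qform_def)
qed

lemma peeled_norm_le:
  assumes "finite S" "psd_on S (\<lambda>i j. a i j - \<zeta> i * cnj (\<zeta> j))"
    and "\<And>i. i \<in> S \<Longrightarrow> Re (a i i) \<le> \<rho>" "i \<in> S"
  shows "cmod (\<zeta> i) \<le> sqrt \<rho>"
proof (rule real_le_rsqrt)
  have "Re (\<zeta> i * cnj (\<zeta> i)) = (cmod (\<zeta> i))\<^sup>2"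
    unfolding complex_norm_square[symmetric] by simp
  then show "(cmod (\<zeta> i))\<^sup>2 \<le> \<rho>"
    using psd_on_diag[OF assms(2,1,4)] assms(3)[OF assms(4)] by simp
qed

lemma crit_pos:
  assumes "0 < \<rho>" "0 < N" "N \<le> M" "\<And>l. l < N \<Longrightarrow> 0 < c l"
  shows "0 < crit \<rho> N M c"
  unfolding crit_def
proof (rule sum_pos)
  fix j assume "j \<in> {..<N}"
  then have "0 < hook_dim N M j" "0 < c j"
    using assms unfolding hook_dim_def by (auto simp: zero_less_binomial_iff)
  then show "0 < (hook_dim N M j)\<^sup>2 * (\<rho> ^ (M - j) / c j)" using assms(1) by simp
qed (use assms in auto)

lemma weighted_Cauchy:
  fixes X t :: "nat \<Rightarrow> complex" and c :: "nat \<Rightarrow> real"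
  assumes "\<And>l. l < N \<Longrightarrow> 0 < c l"
  shows "(cmod (\<Sum>l<N. t l * X l))\<^sup>2
    \<le> (\<Sum>l<N. (cmod (t l))\<^sup>2 / c l) * (\<Sum>l<N. c l * (cmod (X l))\<^sup>2)"
proof -
  have "cmod (\<Sum>l<N. t l * X l)
      \<le> (\<Sum>l<N. (cmod (t l) / sqrt (c l)) * (sqrt (c l) * cmod (X l)))"
    by (rule sum_norm_le) (use assms in \<open>force simp: norm_mult\<close>)
  also have "\<dots> \<le> (\<Sum>l<N. \<bar>cmod (t l) / sqrt (c l)\<bar> * \<bar>sqrt (c l) * cmod (X l)\<bar>)"
    unfolding abs_mult[symmetric] by (intro sum_mono abs_ge_self)
  also have "\<dots> \<le> L2_set (\<lambda>l. cmod (t l) / sqrt (c l)) {..<N} * L2_set (\<lambda>l. sqrt (c l) * cmod (X l)) {..<N}"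
    by (rule L2_set_mult_ineq)
  finally have "(cmod (\<Sum>l<N. t l * X l))\<^sup>2
      \<le> (L2_set (\<lambda>l. cmod (t l) / sqrt (c l)) {..<N} * L2_set (\<lambda>l. sqrt (c l) * cmod (X l)) {..<N})\<^sup>2"
    by (rule power_mono) simp
  also have "\<dots> = (\<Sum>l<N. (cmod (t l) / sqrt (c l))\<^sup>2) * (\<Sum>l<N. (sqrt (c l) * cmod (X l))\<^sup>2)"
    unfolding L2_set_def power_mult_distrib by (simp add: sum_nonneg)
  also have "(\<Sum>l<N. (cmod (t l) / sqrt (c l))\<^sup>2) = (\<Sum>l<N. (cmod (t l))\<^sup>2 / c l)"
    by (intro sum.cong refl) (use assms in \<open>simp add: power_divide less_imp_le\<close>)
  also have "(\<Sum>l<N. (sqrt (c l) * cmod (X l))\<^sup>2) = (\<Sum>l<N. c l * (cmod (X l))\<^sup>2)"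
    by (intro sum.cong refl) (use assms in \<open>simp add: power_mult_distrib less_imp_le\<close>)
  finally show ?thesis .
qed

lemma qform_rank1_power:
  "qform S (\<lambda>i j. (\<zeta> i * cnj (\<zeta> j)) ^ l) v = of_real ((cmod (\<Sum>i\<in>S. cnj (v i) * \<zeta> i ^ l))\<^sup>2)"
  using qform_rank1[of S "\<lambda>i. \<zeta> i ^ l" v] by (simp add: power_mult_distrib)

lemma gap_cnj: "gap K N M c (cnj z) = cnj (gap K N M c z)"
  unfolding gap_def by simp

lemma gap_hermitian:
  assumes "psd_on S a" "i \<in> S" "j \<in> S"
  shows "gap K N M c (a j i) = cnj (gap K N M c (a i j))"
  using psd_on_hermitian[OF assms] by (simp add: gap_cnj)

text \<open>For \<open>\<zeta> \<zeta>\<^sup>*\<close>, the form of the \<open>l\<close>-th entrywise power at \<open>v\<close> is \<open>|X\<^sub>l|\<^sup>2\<close>, where \<open>X\<^sub>l\<close> is the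
  power sum of \<open>\<zeta>\<close> with weights \<open>cnj v\<close>. Interpolating the power \<open>M\<close> at the entries of \<open>\<zeta>\<close>
  expresses \<open>X\<^sub>M\<close> through \<open>X\<^sub>0, \<dots>, X\<^sub>N\<^sub>-\<^sub>1\<close>, and the weighted Cauchy--Schwarz inequality gives
  the constant \<open>K = \<Sum>\<^sub>l |s\<^sub>l|\<^sup>2 / c\<^sub>l\<close>, where \<open>s\<^sub>l\<close> are the hook polynomials at the entries.\<close>

lemma gap_rank1:
  fixes \<zeta> :: "nat \<Rightarrow> complex"
  assumes fin: "finite S" and card: "card S \<le> Suc k" and M: "Suc k \<le> M"
    and c: "\<And>l. l < Suc k \<Longrightarrow> 0 < c l" and r: "0 < r" "\<And>i. i \<in> S \<Longrightarrow> cmod (\<zeta> i) \<le> r"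
  obtains K where "K \<le> crit (r\<^sup>2) (Suc k) M c"
    and "cmod (\<Sum>i\<in>S. \<zeta> i) < real (Suc k) * r \<Longrightarrow> K < crit (r\<^sup>2) (Suc k) M c"
    and "psd_on S (\<lambda>i j. gap K (Suc k) M c (\<zeta> i * cnj (\<zeta> j)))"
proof -
  obtain d where d: "M = k + Suc d" using M by (metis add_Suc_shift le_Suc_ex)
  obtain e where e: "bij_betw e {0..<card S} S" using ex_bij_betw_nat_finite[OF fin] by blast
  \<comment> \<open>Missing nodes are filled up with 0, which makes the bound strict when \<open>S\<close> has fewer than \<open>Suc k\<close> elements.\<close>
  define u where "u m = (if m < card S then \<zeta> (e m) else 0)" for m
  have u_le: "cmod (u m) \<le> r" for m
    using r e unfolding u_def by (auto dest: bij_betwE)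
  have u_sum: "(\<Sum>m\<le>k. u m) = (\<Sum>i\<in>S. \<zeta> i)"
  proof -
    have "(\<Sum>m\<le>k. u m) = (\<Sum>m\<in>{0..<card S}. \<zeta> (e m))"
      unfolding u_def using card by (intro sum.mono_neutral_cong_right) auto
    then show ?thesis using sum.reindex_bij_betw[OF e, of \<zeta>] by simp
  qed
  define s where "s = hook u (Suc k) (Suc d)"
  define t where "t l = (-1) ^ Suc (Suc k + l) * s l" for l
  define K where "K = (\<Sum>l<Suc k. (cmod (s l))\<^sup>2 / c l)"
  have node: "\<zeta> i ^ M = (\<Sum>l<Suc k. t l * \<zeta> i ^ l)" if i: "i \<in> S" for i
  proof -
    obtain m where m: "m < card S" "e m = i" using e i by (metis atLeastLessThan_iff bij_betw_iff_bijections)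
    then have "u m = \<zeta> i" "m \<le> k" using card unfolding u_def by auto
    then show ?thesis
      using hook_interpolant_node[of m k u "Suc d"]
      unfolding hook_interpolant_def d t_def s_def by simp
  qed
  define R where "R = hook (\<lambda>_. r) (Suc k) (Suc d)"
  have R: "(R l)\<^sup>2 / c l = (hook_dim (Suc k) M l)\<^sup>2 * ((r\<^sup>2) ^ (M - l) / c l)" if "l < Suc k" for l
    using hook_const[of l k r "Suc d"] that unfolding R_def d
    by (simp add: power_mult_distrib flip: power_mult) (simp add: mult.commute)
  have crit: "crit (r\<^sup>2) (Suc k) M c = (\<Sum>l<Suc k. (R l)\<^sup>2 / c l)"
    unfolding crit_def by (intro sum.cong refl R[symmetric]) simp
  have s_le: "cmod (s l) \<le> R l" for l
    unfolding s_def R_def using u_le r by (intro hook_norm_le) auto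
  have term_le: "(cmod (s l))\<^sup>2 / c l \<le> (R l)\<^sup>2 / c l" if "l < Suc k" for l
    using s_le[of l] c[OF that] by (intro divide_right_mono power_mono) auto
  have "K \<le> crit (r\<^sup>2) (Suc k) M c"
    unfolding K_def crit by (intro sum_mono) (use term_le in auto)
  moreover have "K < crit (r\<^sup>2) (Suc k) M c" if "cmod (\<Sum>i\<in>S. \<zeta> i) < real (Suc k) * r"
  proof -
    have "cmod (s k) < R k"
      unfolding s_def R_def by (rule hook_top_less) (use r u_le u_sum that in auto)
    then have "(cmod (s k))\<^sup>2 / c k < (R k)\<^sup>2 / c k"
      using c[of k] by (intro divide_strict_right_mono power_strict_mono) auto
    then show ?thesis unfolding K_def crit
      by (intro sum_strict_mono_ex1) (use term_le in auto)
  qed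
  moreover have "psd_on S (\<lambda>i j. gap K (Suc k) M c (\<zeta> i * cnj (\<zeta> j)))"
  proof (rule psd_onI)
    show "gap K (Suc k) M c (\<zeta> j * cnj (\<zeta> i)) = cnj (gap K (Suc k) M c (\<zeta> i * cnj (\<zeta> j)))" for i j
      by (rule gap_hermitian[OF psd_on_rank1[of UNIV]]) auto
    fix v
    define X where "X l = (\<Sum>i\<in>S. cnj (v i) * \<zeta> i ^ l)" for l
    have "X M = (\<Sum>l<Suc k. t l * X l)"
    proof -
      have "X M = (\<Sum>i\<in>S. \<Sum>l<Suc k. cnj (v i) * (t l * \<zeta> i ^ l))"
        unfolding X_def sum_distrib_left[symmetric] by (intro sum.cong refl) (simp only: node)
      also have "\<dots> = (\<Sum>l<Suc k. t l * X l)"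
        unfolding X_def sum_distrib_left
        by (subst sum.swap) (intro sum.cong refl, simp only: ac_simps)
      finally show ?thesis .
    qed
    then have "(cmod (X M))\<^sup>2 \<le> (\<Sum>l<Suc k. (cmod (t l))\<^sup>2 / c l) * (\<Sum>l<Suc k. c l * (cmod (X l))\<^sup>2)"
      using weighted_Cauchy[of "Suc k" c t X] c by simp
    also have "(\<Sum>l<Suc k. (cmod (t l))\<^sup>2 / c l) = K"
      unfolding K_def t_def by (simp add: norm_mult norm_power)
    finally have "(cmod (X M))\<^sup>2 \<le> K * (\<Sum>l<Suc k. c l * (cmod (X l))\<^sup>2)" .
    moreover have "qform S (\<lambda>i j. gap K (Suc k) M c (\<zeta> i * cnj (\<zeta> j))) v
        = of_real (K * (\<Sum>l<Suc k. c l * (cmod (X l))\<^sup>2) - (cmod (X M))\<^sup>2)"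
      unfolding gap_def qform_diff qform_scale qform_sum qform_rank1_power X_def by simp
    ultimately show "0 \<le> Re (qform S (\<lambda>i j. gap K (Suc k) M c (\<zeta> i * cnj (\<zeta> j))) v)" by simp
  qed
  ultimately show ?thesis using that by blast
qed

lemma psd_on_poly:
  assumes "finite S" "psd_on S a" "\<And>l. l < N \<Longrightarrow> 0 \<le> c l"
  shows "psd_on S (\<lambda>i j. \<Sum>l<N. of_real (c l) * a i j ^ l)"
  by (intro psd_on_sum psd_on_scale psd_on_power assms) (use assms(3) in auto)

lemma gap_mono:
  assumes "finite S" "psd_on S a" "\<And>l. l < N \<Longrightarrow> 0 < c l" "K \<le> K'"
    and "psd_on S (\<lambda>i j. gap K N M c (a i j))"
  shows "psd_on S (\<lambda>i j. gap K' N M c (a i j))"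
proof -
  have "psd_on S (\<lambda>i j. of_real (K' - K) * (\<Sum>l<N. of_real (c l) * a i j ^ l))"
    using assms by (intro psd_on_scale psd_on_poly) (auto simp: less_imp_le)
  from psd_on_add[OF assms(5) this] show ?thesis
    by (rule psd_on_cong) (simp add: gap_def algebra_simps)
qed

section \<open>Reduction to rank one\<close>

text \<open>Monotonicity along the segment from \<open>a\<close> to \<open>a + b\<close>: the form of \<open>F[a + t b]\<close> at \<open>v\<close> is a real
  function of \<open>t\<close> whose derivative is the form of the entrywise product of \<open>b\<close> and
  \<open>F'[a + t b]\<close>.\<close>

lemma entrywise_increment:
  assumes F: "\<And>z. (F has_field_derivative F' z) (at z)" "\<And>z. F (cnj z) = cnj (F z)"
    and ab: "psd_on S a" "psd_on S b"
    and mono: "\<And>t. 0 \<le> t \<Longrightarrow> t \<le> 1 \<Longrightarrow> psd_on S (\<lambda>i j. b i j * F' (a i j + of_real t * b i j))"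
  shows "psd_on S (\<lambda>i j. F (a i j + b i j) - F (a i j))"
proof (rule psd_onI)
  show "F (a j i + b j i) - F (a j i) = cnj (F (a i j + b i j) - F (a i j))" if "i \<in> S" "j \<in> S" for i j
    using psd_on_hermitian[OF ab(1) that] psd_on_hermitian[OF ab(2) that]
    by (simp add: F(2) flip: complex_cnj_add)
  fix v
  define \<Phi> where "\<Phi> t = qform S (\<lambda>i j. F (a i j + t * b i j)) v" for t :: complex
  define \<phi> where "\<phi> t = Re (\<Phi> (of_real t))" for t :: real
  have deriv: "(\<phi> has_field_derivative Re (qform S (\<lambda>i j. b i j * F' (a i j + of_real t * b i j)) v)) (at t)"
    (is "(_ has_field_derivative Re ?D) _") for t
  proof -
    have "((\<lambda>t. F (a i j + t * b i j)) has_field_derivative b i j * F' (a i j + of_real t * b i j)) (at (of_real t))" for i j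
    proof -
      have "((\<lambda>t. a i j + t * b i j) has_field_derivative b i j) (at (of_real t))"
        by (rule derivative_eq_intros refl | simp)+
      from DERIV_chain2[OF F(1) this] show ?thesis by (simp add: mult.commute)
    qed
    then have "(\<Phi> has_field_derivative ?D) (at (of_real t))"
      unfolding \<Phi>_def qform_def
      by (intro DERIV_sum DERIV_cmult_right DERIV_cmult)
    then have "(\<Phi> has_derivative (\<lambda>h. ?D * h)) (at (of_real t))"
      by (simp add: has_field_derivative_def)
    then have "((\<lambda>t. Re (\<Phi> (of_real t))) has_derivative (\<lambda>h. Re (?D * of_real h))) (at t)"
      by (intro has_derivative_Re has_derivative_compose[of of_real of_real t _ \<Phi>]
          has_derivative_of_real has_derivative_ident)
    then show ?thesis unfolding \<phi>_def has_field_derivative_def by simp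
  qed
  have "\<phi> 0 \<le> \<phi> 1"
    by (rule DERIV_nonneg_imp_nondecreasing) (use deriv psd_onD[OF mono] in auto)
  then show "0 \<le> Re (qform S (\<lambda>i j. F (a i j + b i j) - F (a i j)) v)"
    by (simp add: \<phi>_def \<Phi>_def qform_diff)
qed

text \<open>The critical constant of the derivative of \<open>gap\<close>, which has one exponent less. The factor
  \<open>k / (M + 1) < 1\<close> is a gain: at the critical constant the increment from rank one is positive
  with room to spare.\<close>

lemma crit_derivative:
  assumes "0 < \<rho>" "k \<le> M" "\<And>l. l < Suc k \<Longrightarrow> 0 < c l"
  shows "real (Suc M) * crit \<rho> k M (\<lambda>l. real (Suc l) * c (Suc l))
    \<le> real k / real (Suc M) * crit \<rho> (Suc k) (Suc M) c"
proof -
  define T where "T j = (hook_dim (Suc k) (Suc M) j)\<^sup>2 * (\<rho> ^ (Suc M - j) / c j)" for j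
  have T0: "0 \<le> T j" if "j < Suc k" for j
    using assms(1) assms(3)[OF that] unfolding T_def by simp
  have term_eq: "real (Suc M) * ((hook_dim k M l)\<^sup>2 * (\<rho> ^ (M - l) / (real (Suc l) * c (Suc l))))
      = real (Suc l) / real (Suc M) * T (Suc l)" for l
  proof -
    have "real (Suc M) * real (M choose l) = real (Suc l) * real (Suc M choose Suc l)"
      unfolding of_nat_mult[symmetric] by (simp only: Suc_times_binomial)
    then have "real (M choose l) = real (Suc l) / real (Suc M) * real (Suc M choose Suc l)"
      by (simp add: field_simps)
    moreover have "hook_dim (Suc k) (Suc M) (Suc l)
        = real (Suc M choose Suc l) * real (M - 1 - l choose (k - 1 - l))"
      unfolding hook_dim_def by (simp del: binomial_Suc_Suc)
    ultimately have dim: "hook_dim k M l = real (Suc l) / real (Suc M) * hook_dim (Suc k) (Suc M) (Suc l)"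
      unfolding hook_dim_def[of k] by (simp only: mult.assoc)
    show ?thesis unfolding T_def dim
      by (simp add: power_mult_distrib power_divide power2_eq_square divide_simps)
  qed
  have "real (Suc M) * crit \<rho> k M (\<lambda>l. real (Suc l) * c (Suc l))
      = (\<Sum>l<k. real (Suc l) / real (Suc M) * T (Suc l))"
    unfolding crit_def sum_distrib_left term_eq ..
  also have "\<dots> \<le> (\<Sum>l<k. real k / real (Suc M) * T (Suc l))"
    by (intro sum_mono mult_right_mono divide_right_mono T0) auto
  also have "\<dots> \<le> real k / real (Suc M) * (T 0 + (\<Sum>l<k. T (Suc l)))"
    unfolding distrib_left sum_distrib_left using T0[of 0] by simp
  also have "T 0 + (\<Sum>l<k. T (Suc l)) = crit \<rho> (Suc k) (Suc M) c"
    unfolding crit_def T_def by (rule sum.lessThan_Suc_shift[symmetric])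
  finally show ?thesis .
qed

lemma gap_deriv:
  "(gap K (Suc k) (Suc M) c has_field_derivative
     of_real (real (Suc M)) * gap (K / real (Suc M)) k M (\<lambda>l. real (Suc l) * c (Suc l)) z) (at z)"
proof -
  have 1: "gap K (Suc k) (Suc M) c
      = (\<lambda>z. of_real K * (of_real (c 0) + (\<Sum>l<k. of_real (c (Suc l)) * z ^ Suc l)) - z ^ Suc M)"
    unfolding gap_def sum.lessThan_Suc_shift by simp
  have 2: "of_real (real (Suc M)) * gap (K / real (Suc M)) k M (\<lambda>l. real (Suc l) * c (Suc l)) z
     = of_real K * (\<Sum>l<k. of_real (c (Suc l)) * (of_nat (Suc l) * z ^ l)) - of_nat (Suc M) * z ^ M"
    unfolding gap_def right_diff_distrib of_real_of_nat_eq of_real_divide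
    by (simp add: mult_ac del: of_nat_Suc)
  have 3: "((\<lambda>z. z ^ Suc m) has_field_derivative of_nat (Suc m) * z ^ m) (at z)" for m
    using DERIV_power_Suc[OF DERIV_ident, of m z] by simp
  show ?thesis unfolding 1 2
    by (rule derivative_eq_intros 3 refl | simp add: ac_simps del: power_Suc of_nat_Suc)+
qed

text \<open>The step of FitzGerald and Horn: along the segment from \<open>\<zeta> \<zeta>\<^sup>*\<close> to \<open>a\<close> the increment
  \<open>a - \<zeta> \<zeta>\<^sup>*\<close> vanishes on the row and column \<open>p\<close>, so that positivity of the derivative is needed
  only on \<open>S - {p}\<close>, in dimension at most \<open>k\<close>. The last hypothesis is the result in that
  dimension.\<close>

lemma gap_increment:
  assumes fin: "finite S" and card: "card S \<le> Suc k" and M: "k \<le> M" and \<rho>: "0 < \<rho>"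
    and c: "\<And>l. l < Suc k \<Longrightarrow> 0 < c l"
    and a: "psd_on S a" and diag: "\<And>i. i \<in> S \<Longrightarrow> Re (a i i) \<le> \<rho>"
    and p: "p \<in> S" and z: "psd_on S (\<lambda>i j. a i j - \<zeta> i * cnj (\<zeta> j))"
      "\<And>i. i \<in> S \<Longrightarrow> a i p = \<zeta> i * cnj (\<zeta> p)" "\<And>i. i \<in> S \<Longrightarrow> a p i = \<zeta> p * cnj (\<zeta> i)"
    and K: "real k / real (Suc M) * crit \<rho> (Suc k) (Suc M) c \<le> K"
    and lower: "\<And>T c b K. finite T \<Longrightarrow> card T \<le> k \<Longrightarrow> (\<And>l. l < k \<Longrightarrow> 0 < c l) \<Longrightarrow>
      psd_on T b \<Longrightarrow> (\<And>i. i \<in> T \<Longrightarrow> Re (b i i) \<le> \<rho>) \<Longrightarrow> crit \<rho> k M c \<le> K \<Longrightarrow>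
      psd_on T (\<lambda>i j. gap K k M c (b i j))"
  shows "psd_on S (\<lambda>i j. gap K (Suc k) (Suc M) c (a i j) - gap K (Suc k) (Suc M) c (\<zeta> i * cnj (\<zeta> j)))"
proof -
  define x where "x = (\<lambda>i j. \<zeta> i * cnj (\<zeta> j))"
  define y where "y = (\<lambda>i j. a i j - x i j)"
  define c' where "c' = (\<lambda>l. real (Suc l) * c (Suc l))"
  have x_psd: "psd_on S x" unfolding x_def by (rule psd_on_rank1)
  have y_psd: "psd_on S y" using z(1) unfolding x_def y_def .
  have K': "crit \<rho> k M c' \<le> K / real (Suc M)"
    using order_trans[OF crit_derivative[OF \<rho> M c] K] unfolding c'_def
    by (simp add: pos_le_divide_eq mult.commute)
  have "psd_on S (\<lambda>i j. y i j * (of_real (real (Suc M)) * gap (K / real (Suc M)) k M c' (x i j + of_real t * y i j)))"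
    if t: "0 \<le> t" "t \<le> 1" for t
  proof (rule psd_on_extend_zero[OF _ fin])
    define b where "b = (\<lambda>i j. x i j + of_real t * y i j)"
    have b_psd: "psd_on S b" unfolding b_def
      by (intro psd_on_add psd_on_scale x_psd y_psd t)
    have b_diag: "Re (b i i) \<le> \<rho>" if i: "i \<in> S" for i
    proof -
      have "0 \<le> Re (y i i)" by (rule psd_on_diag[OF y_psd fin i])
      then have "t * Re (y i i) \<le> Re (y i i)" using t by (simp add: mult_left_le_one_le)
      then show ?thesis using diag[OF i] unfolding b_def y_def by simp
    qed
    have "psd_on (S - {p}) (\<lambda>i j. gap (K / real (Suc M)) k M c' (b i j))"
    proof (rule lower)
      show "card (S - {p}) \<le> k" using card p fin by simp
      show "psd_on (S - {p}) b" by (rule psd_on_subset[OF b_psd fin]) auto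
    qed (use fin c b_diag K' in \<open>auto simp: c'_def\<close>)
    moreover have "psd_on (S - {p}) y" by (rule psd_on_subset[OF y_psd fin]) auto
    ultimately show "psd_on (S - {p}) (\<lambda>i j. y i j * (of_real (real (Suc M)) * gap (K / real (Suc M)) k M c' (x i j + of_real t * y i j)))"
      unfolding b_def[symmetric] using fin by (intro schur_product psd_on_scale) (auto simp: b_def)
  qed (use z in \<open>auto simp: y_def x_def\<close>)
  then have "psd_on S (\<lambda>i j. gap K (Suc k) (Suc M) c (x i j + y i j) - gap K (Suc k) (Suc M) c (x i j))"
    unfolding c'_def by (intro entrywise_increment[OF gap_deriv gap_cnj x_psd y_psd])
  then show ?thesis unfolding y_def x_def by simp
qed

text \<open>The rank-one case, plus the increment from it to \<open>a\<close>. The increment alone would be positive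
  for the smaller constant \<open>k / M\<close> times the critical one.\<close>

lemma gap_psd:
  assumes "finite S" "card S \<le> N" "N \<le> M" "0 < \<rho>" "\<And>l. l < N \<Longrightarrow> 0 < c l"
    and "psd_on S a" "\<And>i. i \<in> S \<Longrightarrow> Re (a i i) \<le> \<rho>" "crit \<rho> N M c \<le> K"
  shows "psd_on S (\<lambda>i j. gap K N M c (a i j))"
  using assms
proof (induction N arbitrary: M S c a K)
  case 0
  then show ?case by (simp add: psd_on_def hermitian_on_def qform_def)
next
  case (Suc k)
  show ?case
  proof (cases "S = {}")
    case True
    then show ?thesis by (simp add: psd_on_def hermitian_on_def qform_def)
  next
    case False
    then obtain p where p: "p \<in> S" by blast
    obtain M' where M': "M = Suc M'" "k \<le> M'" using Suc.prems(3) by (cases M) auto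
    obtain \<zeta> where z: "psd_on S (\<lambda>i j. a i j - \<zeta> i * cnj (\<zeta> j))"
      "\<And>i. i \<in> S \<Longrightarrow> a i p = \<zeta> i * cnj (\<zeta> p)" "\<And>i. i \<in> S \<Longrightarrow> a p i = \<zeta> p * cnj (\<zeta> i)"
      by (rule peel[OF Suc.prems(1,6) p]) (rule that)
    have crit0: "0 < crit \<rho> (Suc k) M c" by (rule crit_pos) (use Suc.prems in auto)
    obtain K0 where K0: "K0 \<le> crit ((sqrt \<rho>)\<^sup>2) (Suc k) M c"
      "psd_on S (\<lambda>i j. gap K0 (Suc k) M c (\<zeta> i * cnj (\<zeta> j)))"
      using gap_rank1[where r = "sqrt \<rho>" and \<zeta> = \<zeta> and c = c, OF Suc.prems(1,2,3,5)]
        peeled_norm_le[OF Suc.prems(1) z(1) Suc.prems(7)] Suc.prems(4)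
      by (metis real_sqrt_gt_zero)
    have "K0 \<le> K" using K0(1) Suc.prems(4,8) by simp
    then have "psd_on S (\<lambda>i j. gap K (Suc k) M c (\<zeta> i * cnj (\<zeta> j)))"
      using gap_mono[OF Suc.prems(1) psd_on_rank1 Suc.prems(5) _ K0(2)] by simp
    moreover have "psd_on S (\<lambda>i j. gap K (Suc k) M c (a i j) - gap K (Suc k) M c (\<zeta> i * cnj (\<zeta> j)))"
      unfolding M'(1)
    proof (rule gap_increment[OF Suc.prems(1,2) M'(2) Suc.prems(4,5,6,7) p z])
      have "real k / real (Suc M') * crit \<rho> (Suc k) M c \<le> 1 * crit \<rho> (Suc k) M c"
        using crit0 M'(2) by (intro mult_right_mono) auto
      then show "real k / real (Suc M') * crit \<rho> (Suc k) (Suc M') c \<le> K"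
        using Suc.prems(8) unfolding M'(1) by simp
    qed (use Suc.IH M'(2) Suc.prems(4) in auto)
    ultimately show ?thesis by (rule psd_on_cong[OF psd_on_add]) simp
  qed
qed

text \<open>Equality in the triangle inequality with bound \<open>N r\<close> requires \<open>N\<close> summands, all equal.\<close>

lemma norm_sum_less:
  fixes \<zeta> :: "nat \<Rightarrow> complex"
  assumes fin: "finite S" and r: "0 < r" "\<And>i. i \<in> S \<Longrightarrow> cmod (\<zeta> i) \<le> r" and card: "card S \<le> N"
    and strict: "card S < N \<or> (\<exists>i\<in>S. \<exists>j\<in>S. \<zeta> i \<noteq> \<zeta> j)"
  shows "cmod (\<Sum>i\<in>S. \<zeta> i) < real N * r"
proof (cases "card S < N")
  case True
  have "cmod (\<Sum>i\<in>S. \<zeta> i) \<le> real (card S) * r"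
    using sum_norm_bound[of S \<zeta> r] r(2) by simp
  also have "\<dots> < real N * r" using True r(1) by simp
  finally show ?thesis .
next
  case False
  then obtain i j where ij: "i \<in> S" "j \<in> S" "\<zeta> i \<noteq> \<zeta> j" using strict by blast
  then have "i \<noteq> j" by auto
  \<comment> \<open>The parallelogram law gives strict convexity of the disc.\<close>
  have "(cmod (\<zeta> i + \<zeta> j))\<^sup>2 + (cmod (\<zeta> i - \<zeta> j))\<^sup>2 = 2 * (cmod (\<zeta> i))\<^sup>2 + 2 * (cmod (\<zeta> j))\<^sup>2"
    unfolding cmod_power2 by (simp add: power2_eq_square algebra_simps)
  moreover have "(cmod (\<zeta> i))\<^sup>2 \<le> r\<^sup>2" "(cmod (\<zeta> j))\<^sup>2 \<le> r\<^sup>2" using r ij by (auto intro: power_mono)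
  moreover have "0 < (cmod (\<zeta> i - \<zeta> j))\<^sup>2" using ij by simp
  moreover have "(2 * r)\<^sup>2 = 4 * r\<^sup>2" by (simp add: power_mult_distrib)
  ultimately have "(cmod (\<zeta> i + \<zeta> j))\<^sup>2 < (2 * r)\<^sup>2" by linarith
  then have "cmod (\<zeta> i + \<zeta> j) < 2 * r" using r(1) power2_less_imp_less by fastforce
  moreover have "cmod (\<Sum>l\<in>S-{i,j}. \<zeta> l) \<le> real (card (S - {i,j})) * r"
    using sum_norm_bound[of "S-{i,j}" \<zeta> r] r(2) by simp
  moreover have "(\<Sum>l\<in>S. \<zeta> l) = (\<zeta> i + \<zeta> j) + (\<Sum>l\<in>S-{i,j}. \<zeta> l)"
    using sum.subset_diff[of "{i,j}" S \<zeta>] fin ij \<open>i \<noteq> j\<close> by (simp add: add.commute)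
  moreover have "card S = card (S - {i,j}) + 2"
    using card_Diff_subset[of "{i,j}" S] card_mono[OF fin, of "{i,j}"] ij \<open>i \<noteq> j\<close> by auto
  ultimately have "cmod (\<Sum>l\<in>S. \<zeta> l) < real (card S) * r"
    using norm_triangle_ineq[of "\<zeta> i + \<zeta> j" "\<Sum>l\<in>S-{i,j}. \<zeta> l"] by (simp add: algebra_simps)
  also have "\<dots> \<le> real N * r" using card r(1) by simp
  finally show ?thesis .
qed

text \<open>The critical constant is not attained on a matrix of smaller size or on a non-constant one. In
  the second case, splitting off a column \<open>p\<close> that is not constant gives a vector \<open>\<zeta>\<close> that is
  not constant. In both cases the rank-one bound for \<open>\<zeta>\<close> is strict, while the increment from
  \<open>\<zeta> \<zeta>\<^sup>*\<close> to \<open>a\<close> never uses the full constant.\<close>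

lemma gap_psd_below_crit:
  assumes fin: "finite S" and card: "card S \<le> N" "N \<le> M" and \<rho>: "0 < \<rho>"
    and c: "\<And>l. l < N \<Longrightarrow> 0 < c l"
    and a: "psd_on S a" and diag: "\<And>i. i \<in> S \<Longrightarrow> Re (a i i) \<le> \<rho>" and ne: "S \<noteq> {}"
    and nonconst: "card S < N \<or> (\<exists>p\<in>S. \<exists>i\<in>S. \<exists>j\<in>S. a i p \<noteq> a j p)"
  obtains K where "0 \<le> K" "K < crit \<rho> N M c" "psd_on S (\<lambda>i j. gap K N M c (a i j))"
proof -
  obtain k where k: "N = Suc k" using ne fin card(1) by (cases N) auto
  obtain M' where M': "M = Suc M'" "k \<le> M'" using card(2) k by (cases M) auto
  obtain p where p: "p \<in> S" "card S < N \<or> (\<exists>i\<in>S. \<exists>j\<in>S. a i p \<noteq> a j p)"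
    using ne nonconst by blast
  obtain \<zeta> where z: "psd_on S (\<lambda>i j. a i j - \<zeta> i * cnj (\<zeta> j))"
    "\<And>i. i \<in> S \<Longrightarrow> a i p = \<zeta> i * cnj (\<zeta> p)" "\<And>i. i \<in> S \<Longrightarrow> a p i = \<zeta> p * cnj (\<zeta> i)"
    by (rule peel[OF fin a p(1)]) (rule that)
  have z_le: "cmod (\<zeta> i) \<le> sqrt \<rho>" if "i \<in> S" for i
    using peeled_norm_le[OF fin z(1) diag that] by simp
  have "card S < N \<or> (\<exists>i\<in>S. \<exists>j\<in>S. \<zeta> i \<noteq> \<zeta> j)" using p(2) z(2) by metis
  then have small: "cmod (\<Sum>i\<in>S. \<zeta> i) < real N * sqrt \<rho>"
    using norm_sum_less[OF fin _ z_le card(1)] \<rho> by simp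
  obtain K0 where K0: "K0 < crit \<rho> N M c" "psd_on S (\<lambda>i j. gap K0 N M c (\<zeta> i * cnj (\<zeta> j)))"
    using gap_rank1[where r = "sqrt \<rho>" and \<zeta> = \<zeta> and c = c, OF fin card(1)[unfolded k]
        card(2)[unfolded k] c[unfolded k] _ z_le] small \<rho> unfolding k
    by (metis real_sqrt_gt_zero real_sqrt_pow2 less_imp_le)
  have crit0: "0 < crit \<rho> N M c" by (rule crit_pos) (use \<rho> k card c in auto)
  define K1 where "K1 = real k / real M * crit \<rho> N M c"
  define K where "K = max K0 K1"
  have "real k / real M < 1" using M' by simp
  then have "K1 < 1 * crit \<rho> N M c" unfolding K1_def using crit0 by (intro mult_strict_right_mono)
  then have "K < crit \<rho> N M c" using K0(1) unfolding K_def by simp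
  moreover have "0 \<le> K" unfolding K_def K1_def using crit0 by (simp add: le_max_iff_disj)
  moreover have "psd_on S (\<lambda>i j. gap K N M c (a i j))"
  proof -
    have "psd_on S (\<lambda>i j. gap K N M c (\<zeta> i * cnj (\<zeta> j)))"
      using gap_mono[OF fin psd_on_rank1 c _ K0(2)] unfolding K_def by simp
    moreover have "psd_on S (\<lambda>i j. gap K N M c (a i j) - gap K N M c (\<zeta> i * cnj (\<zeta> j)))"
      unfolding k M'(1)
    proof (rule gap_increment[OF fin card(1)[unfolded k] M'(2) \<rho> c[unfolded k] a diag p(1) z])
      show "real k / real (Suc M') * crit \<rho> (Suc k) (Suc M') c \<le> K"
        unfolding K_def K1_def k M'(1) by simp
    qed (use gap_psd[OF _ _ M'(2) \<rho>] in auto)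
    ultimately show ?thesis by (rule psd_on_cong[OF psd_on_add]) simp
  qed
  ultimately show ?thesis using that by blast
qed

section \<open>Definiteness on matrices with distinct rows\<close>

lemma exists_nonvanishing_combination:
  fixes D :: "(nat \<Rightarrow> complex) set"
  assumes "finite S" "finite D" "\<And>d. d \<in> D \<Longrightarrow> \<exists>j\<in>S. d j \<noteq> 0"
  obtains w where "\<And>d. d \<in> D \<Longrightarrow> (\<Sum>j\<in>S. d j * w j) \<noteq> 0"
proof -
  \<comment> \<open>With \<open>w\<^sub>j = t\<^sup>j\<close> each combination is a non-zero polynomial in \<open>t\<close>, and finitely many of them have finitely many roots.\<close>
  define P where "P d = (\<Sum>j\<in>S. monom (d j) j)" for d :: "nat \<Rightarrow> complex"
  have "P d \<noteq> 0" if d: "d \<in> D" for d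
  proof -
    obtain j where j: "j \<in> S" "d j \<noteq> 0" using assms(3)[OF d] by blast
    then have "coeff (P d) j = d j" using assms(1) unfolding P_def by (simp add: coeff_sum)
    then show ?thesis using j by auto
  qed
  then have "finite (\<Union>d\<in>D. {t. poly (P d) t = 0})"
    using assms(2) poly_roots_finite by blast
  then obtain t where t: "t \<notin> (\<Union>d\<in>D. {t. poly (P d) t = 0})"
    using ex_new_if_finite infinite_UNIV_char_0 by blast
  have "(\<Sum>j\<in>S. d j * t ^ j) \<noteq> 0" if "d \<in> D" for d
    using t that unfolding P_def by (auto simp: poly_sum poly_monom)
  then show ?thesis using that[of "\<lambda>j. t ^ j"] by blast
qed

text \<open>The invertibility of a Vandermonde matrix, tested on the Lagrange polynomial that vanishes at
  all nodes but one.\<close>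

lemma power_sums_zero:
  fixes y \<zeta> :: "nat \<Rightarrow> complex"
  assumes fin: "finite S" and card: "card S \<le> N" and inj: "inj_on \<zeta> S"
    and zero: "\<And>l. l < N \<Longrightarrow> (\<Sum>i\<in>S. y i * \<zeta> i ^ l) = 0"
    and k: "k \<in> S"
  shows "y k = 0"
proof -
  define p where "p = (\<Prod>i\<in>S-{k}. [:- \<zeta> i, 1:])"
  have "degree p = card (S - {k})"
    unfolding p_def using fin by (subst degree_prod_eq_sum_degree) auto
  then have deg: "degree p < N" using card k fin card_Diff1_less[OF fin k] by linarith
  have roots: "poly p (\<zeta> i) = 0" if "i \<in> S" "i \<noteq> k" for i
    unfolding p_def using that fin by (auto simp: poly_prod)
  have nz: "poly p (\<zeta> k) \<noteq> 0"
    unfolding p_def poly_prod using fin inj k by (auto dest: inj_onD)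
  have "(\<Sum>i\<in>S. y i * poly p (\<zeta> i)) = (\<Sum>l\<le>degree p. coeff p l * (\<Sum>i\<in>S. y i * \<zeta> i ^ l))"
    unfolding poly_altdef sum_distrib_left
    by (subst sum.swap) (intro sum.cong refl, simp only: ac_simps)
  also have "\<dots> = 0" using zero deg by (intro sum.neutral) auto
  finally have "y k * poly p (\<zeta> k) = 0"
    using roots k fin by (simp add: sum.remove[OF fin k])
  then show ?thesis using nz by simp
qed

text \<open>Since the rows of \<open>a\<close> are distinct, and non-zero if \<open>m > 0\<close>, so are the entries of \<open>a w\<close> for a
  generic \<open>w\<close>. Then \<open>a\<close> dominates a rank-one matrix \<open>\<zeta> \<zeta>\<^sup>*\<close> with \<open>\<zeta>\<close> proportional to \<open>a w\<close>, and
  each entrywise power of \<open>a\<close> dominates that of \<open>\<zeta> \<zeta>\<^sup>*\<close>. A null vector of the form annihilates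
  the powers of \<open>\<zeta>\<close> with the \<open>N\<close> consecutive exponents \<open>m, \<dots>, m + N - 1\<close>, hence is zero.\<close>

lemma power_sum_definite:
  assumes fin: "finite S" and card: "card S \<le> N" and a: "psd_on S a"
    and rows: "\<And>i k. i \<in> S \<Longrightarrow> k \<in> S \<Longrightarrow> i \<noteq> k \<Longrightarrow> \<exists>j\<in>S. a i j \<noteq> a k j"
    and nonzero: "\<And>i. i \<in> S \<Longrightarrow> m = 0 \<or> (\<exists>j\<in>S. a i j \<noteq> 0)"
    and c: "\<And>l. l < N \<Longrightarrow> 0 < c l"
    and v: "Re (qform S (\<lambda>i j. \<Sum>l<N. of_real (c l) * a i j ^ (m + l)) v) \<le> 0"
    and k: "k \<in> S"
  shows "v k = 0"
proof -
  define D where "D = {d. \<exists>i\<in>S. \<exists>k\<in>S. i \<noteq> k \<and> d = (\<lambda>j. a i j - a k j)} \<union> {d. m \<noteq> 0 \<and> (\<exists>i\<in>S. d = a i)}"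
  have "D \<subseteq> (\<lambda>(i, k) j. a i j - a k j) ` (S \<times> S) \<union> a ` S" unfolding D_def by auto
  then have "finite D" by (rule finite_subset) (use fin in auto)
  moreover have "\<exists>j\<in>S. d j \<noteq> 0" if "d \<in> D" for d
    using that rows nonzero unfolding D_def by fastforce
  ultimately obtain w where w: "\<And>d. d \<in> D \<Longrightarrow> (\<Sum>j\<in>S. d j * w j) \<noteq> 0"
    using exists_nonvanishing_combination[OF fin] by metis
  define x where "x = (\<lambda>i. \<Sum>j\<in>S. a i j * w j)"
  define \<kappa> where "\<kappa> = sqrt (Re (qform S a w))"
  define \<zeta> where "\<zeta> = (\<lambda>i. x i / of_real \<kappa>)"
  have z: "psd_on S (\<lambda>i j. a i j - \<zeta> i * cnj (\<zeta> j))"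
    using schur_complement(1)[OF fin a, of w] unfolding x_def \<kappa>_def \<zeta>_def .
  have xz: "x i = of_real \<kappa> * \<zeta> i" if "i \<in> S" for i
    using schur_complement(2)[OF fin a that, of w] unfolding x_def \<kappa>_def \<zeta>_def .
  have "inj_on \<zeta> S"
  proof (rule inj_onI, rule ccontr)
    fix i k assume ik: "i \<in> S" "k \<in> S" "\<zeta> i = \<zeta> k" "i \<noteq> k"
    then have "(\<lambda>j. a i j - a k j) \<in> D" unfolding D_def by blast
    from w[OF this] have "x i \<noteq> x k" unfolding x_def by (auto simp: algebra_simps sum_subtractf)
    then show False using xz ik by simp
  qed
  moreover have "\<zeta> k \<noteq> 0" if "m \<noteq> 0"
  proof -
    have "a k \<in> D" using that k unfolding D_def by blast
    from w[OF this] show ?thesis using xz[OF k] unfolding x_def by auto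
  qed
  moreover have "cnj (v k) * \<zeta> k ^ m = 0"
  proof (rule power_sums_zero[OF fin card \<open>inj_on \<zeta> S\<close> _ k, of "\<lambda>i. cnj (v i) * \<zeta> i ^ m"])
    fix l assume l: "l < N"
    define q where "q l = Re (qform S (\<lambda>i j. a i j ^ (m + l)) v)" for l
    have q0: "0 \<le> q l" for l unfolding q_def using psd_onD[OF psd_on_power[OF fin a]] .
    have "Re (qform S (\<lambda>i j. \<Sum>l<N. of_real (c l) * a i j ^ (m + l)) v) = (\<Sum>l<N. c l * q l)"
      unfolding qform_sum qform_scale q_def by simp
    then have "(\<Sum>l<N. c l * q l) = 0"
      using v q0 c by (intro antisym sum_nonneg) (auto simp: less_imp_le)
    then have "c l * q l = 0"
      using sum_nonneg_eq_0_iff[of "{..<N}" "\<lambda>l. c l * q l"] q0 c l by (auto simp: less_imp_le)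
    then have "q l = 0" using c[OF l] by simp
    moreover have "(cmod (\<Sum>i\<in>S. cnj (v i) * \<zeta> i ^ (m + l)))\<^sup>2 \<le> q l"
      using psd_onD[OF power_dominates_rank1[OF fin a z, of "m + l"], of v]
      unfolding qform_diff qform_rank1_power q_def by simp
    ultimately have "(\<Sum>i\<in>S. cnj (v i) * \<zeta> i ^ (m + l)) = 0" by simp
    then show "(\<Sum>i\<in>S. cnj (v i) * \<zeta> i ^ m * \<zeta> i ^ l) = 0" by (simp add: power_add mult.assoc)
  qed
  ultimately show ?thesis by (cases "m = 0") auto
qed

text \<open>The matrix \<open>f[a]\<close> dominates a positive multiple of \<open>h[a]\<close>, where \<open>h\<close> is \<open>f\<close> without its last
  term. This is clear for \<open>c' \<ge> 0\<close>. For \<open>c' < 0\<close> it holds because \<open>a\<^sup>M \<le> K h\<^sub>0[a]\<close> with some \<open>K\<close>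
  strictly below the critical constant, \<open>h\<^sub>0\<close> being \<open>h\<close> divided by \<open>z\<^sup>m\<close>; the Schur product with
  \<open>a\<^sup>m\<close> transfers this to the exponents \<open>m, m + 1, \<dots>\<close>.\<close>

lemma perturbed_definite:
  assumes fin: "finite S" "S \<noteq> {}" and card: "card S \<le> N" and N: "2 \<le> N" "N \<le> M"
    and \<rho>: "0 < \<rho>" and a: "psd_on S a" and diag: "\<And>i. i \<in> S \<Longrightarrow> Re (a i i) \<le> \<rho>"
    and rows: "\<And>i k. i \<in> S \<Longrightarrow> k \<in> S \<Longrightarrow> i \<noteq> k \<Longrightarrow> \<exists>j\<in>S. a i j \<noteq> a k j"
    and nonzero: "\<And>i. i \<in> S \<Longrightarrow> m = 0 \<or> (\<exists>j\<in>S. a i j \<noteq> 0)"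
    and c: "\<And>l. l < N \<Longrightarrow> 0 < c l" and c': "- inverse (crit \<rho> N M c) \<le> c'"
    and v: "Re (qform S (\<lambda>i j. (\<Sum>l<N. of_real (c l) * a i j ^ (m + l)) + of_real c' * a i j ^ (m + M)) v) \<le> 0"
    and k: "k \<in> S"
  shows "v k = 0"
proof -
  define h where "h = (\<lambda>i j. \<Sum>l<N. of_real (c l) * a i j ^ (m + l))"
  define f where "f = (\<lambda>i j. h i j + of_real c' * a i j ^ (m + M))"
  have crit0: "0 < crit \<rho> N M c" using crit_pos[OF \<rho> _ N(2) c] N by simp
  have "\<exists>\<delta>>0. psd_on S (\<lambda>i j. f i j - of_real \<delta> * h i j)"
  proof (cases "0 \<le> c'")
    case True
    have "psd_on S (\<lambda>i j. of_real c' * a i j ^ (m + M))"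
      by (intro psd_on_scale psd_on_power True fin a)
    then have "psd_on S (\<lambda>i j. f i j - of_real 1 * h i j)"
      by (rule psd_on_cong) (simp add: f_def)
    moreover have "0 < (1 :: real)" by simp
    ultimately show ?thesis by (intro exI[of _ "1::real"] conjI)
  next
    case False
    have nonconst: "card S < N \<or> (\<exists>p\<in>S. \<exists>i\<in>S. \<exists>j\<in>S. a i p \<noteq> a j p)"
    proof (rule disjCI)
      assume "\<not> (\<exists>p\<in>S. \<exists>i\<in>S. \<exists>j\<in>S. a i p \<noteq> a j p)"
      then have "\<And>i k. i \<in> S \<Longrightarrow> k \<in> S \<Longrightarrow> i = k" using rows by metis
      then have "card S \<le> 1" using fin(1) by (simp add: card_le_Suc0_iff_eq)
      then show "card S < N" using N by simp
    qed
    obtain K where K: "0 \<le> K" "K < crit \<rho> N M c" "psd_on S (\<lambda>i j. gap K N M c (a i j))"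
      by (rule gap_psd_below_crit[where c = c, OF fin(1) card N(2) \<rho> c a diag fin(2) nonconst])
        (assumption | rule that)+
    have "- c' * K \<le> inverse (crit \<rho> N M c) * K" using c' K(1) by (intro mult_right_mono) auto
    also have "\<dots> < 1" using K(2) crit0 by (simp add: field_simps)
    finally have "0 < 1 + c' * K" by simp
    have "psd_on S (\<lambda>i j. of_real (- c') * (a i j ^ m * gap K N M c (a i j)))"
      using False by (intro psd_on_scale schur_product psd_on_power fin a K) auto
    then have "psd_on S (\<lambda>i j. f i j - of_real (1 + c' * K) * h i j)"
      by (rule psd_on_cong)
        (simp add: f_def h_def gap_def power_add algebra_simps sum_distrib_left sum_negf)
    then show ?thesis using \<open>0 < 1 + c' * K\<close> by (intro exI[of _ "1 + c' * K"] conjI)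
  qed
  then obtain \<delta> where \<delta>: "0 < \<delta>" "psd_on S (\<lambda>i j. f i j - of_real \<delta> * h i j)" by blast
  have "\<delta> * Re (qform S h v) \<le> Re (qform S f v)"
    using psd_onD[OF \<delta>(2), of v] unfolding qform_diff qform_scale by simp
  also have "\<dots> \<le> 0" using v unfolding f_def h_def .
  finally have "Re (qform S h v) \<le> 0" using \<delta>(1) by (simp add: mult_le_0_iff)
  then have "Re (qform S (\<lambda>i j. \<Sum>l<N. of_real (c l) * a i j ^ (m + l)) v) \<le> 0"
    unfolding h_def .
  from power_sum_definite[where c = c and v = v, OF fin(1) card a rows nonzero c this k]
  show ?thesis .
qed

section \<open>Rank and blocks\<close>

lemma rank_eq_card_representatives:
  assumes F: "F \<in> carrier_mat N N" and R: "R \<subseteq> {0..<N}"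
    and rep: "\<And>j. j < N \<Longrightarrow> \<exists>r\<in>R. col F j = col F r"
    and indep: "\<And>v k. (\<And>i. i \<in> R \<Longrightarrow> (\<Sum>j\<in>R. F $$ (i, j) * v j) = 0) \<Longrightarrow> k \<in> R \<Longrightarrow> v k = (0 :: complex)"
  shows "vec_space.rank N F = card R"
proof -
  interpret vec_space "TYPE(complex)" N .
  have fin: "finite R" using R finite_subset by blast
  have entry: "col F r $ i = F $$ (i, r)" if "i \<in> R" "r \<in> R" for i r
    using that R F by (metis atLeastLessThan_iff carrier_matD(1) carrier_matD(2) index_col subsetD)
  have cols: "set (cols F) = col F ` R"
  proof
    show "set (cols F) \<subseteq> col F ` R" using rep F by (auto simp: cols_def image_iff)
    show "col F ` R \<subseteq> set (cols F)" using R F by (auto simp: cols_def)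
  qed
  have inj: "inj_on (col F) R"
  proof (rule inj_onI, rule ccontr)
    fix r s assume rs: "r \<in> R" "s \<in> R" "col F r = col F s" "r \<noteq> s"
    define v :: "nat \<Rightarrow> complex" where "v = (\<lambda>j. (if j = r then 1 else 0) - (if j = s then 1 else 0))"
    have "v r = 0"
    proof (rule indep)
      fix i assume i: "i \<in> R"
      have "(\<Sum>j\<in>R. F $$ (i, j) * v j) = F $$ (i, r) - F $$ (i, s)"
        unfolding v_def using fin rs by (simp add: right_diff_distrib sum_subtractf if_distrib[of "\<lambda>c. _ * c"] cong: if_cong)
      also have "\<dots> = 0" using entry[OF i rs(1)] entry[OF i rs(2)] rs(3) by simp
      finally show "(\<Sum>j\<in>R. F $$ (i, j) * v j) = 0" .
    qed fact
    then show False using rs(4) unfolding v_def by simp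
  qed
  have "lin_indpt (set (cols F))"
  proof (rule finite_lin_indpt2)
    show carrier: "set (cols F) \<subseteq> carrier_vec N" using cols_dim[of F] F by simp
    fix a assume a: "lincomb a (set (cols F)) = 0\<^sub>v N"
    have "a (col F k) = 0" if "k \<in> R" for k
    proof (rule indep[OF _ that, of "\<lambda>r. a (col F r)"])
      fix i assume i: "i \<in> R"
      then have iN: "i < N" using R by auto
      have "0 = lincomb a (set (cols F)) $ i" unfolding a using iN by simp
      also have "\<dots> = (\<Sum>x\<in>set (cols F). a x * x $ i)"
        using lincomb_index[OF iN, of "set (cols F)" a] carrier by simp
      also have "\<dots> = (\<Sum>r\<in>R. a (col F r) * col F r $ i)"
        unfolding cols by (simp add: sum.reindex[OF inj])
      also have "\<dots> = (\<Sum>j\<in>R. F $$ (i, j) * a (col F j))"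
        by (intro sum.cong refl) (simp add: entry[OF i])
      finally show "(\<Sum>j\<in>R. F $$ (i, j) * a (col F j)) = 0" by simp
    qed
    then show "\<forall>v\<in>set (cols F). a v = 0" unfolding cols by auto
  qed simp
  then have "rank F = card (set (cols F))"
    by (intro rank_card_indpt[OF F]) (auto simp: maximal_def)
  then show ?thesis unfolding cols using card_image[OF inj] by simp
qed

text \<open>Equality of rows is an equivalence relation, and for a Hermitian matrix its classes form a
  block-constant partition; by minimality every class lies in a single block. Hence rows of
  indices from different blocks differ, and one index from each block, here the least, suffices.\<close>

lemma block_representatives:
  assumes herm: "\<And>i j. i < N \<Longrightarrow> j < N \<Longrightarrow> A $$ (j, i) = cnj (A $$ (i, j))"
  obtains R where "R \<subseteq> {0..<N}" "card R = card (block_partition N A)"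
    and "\<And>j. j < N \<Longrightarrow> \<exists>r\<in>R. \<forall>i<N. A $$ (i, j) = A $$ (i, r)"
    and "\<And>i k. i \<in> R \<Longrightarrow> k \<in> R \<Longrightarrow> i \<noteq> k \<Longrightarrow> \<exists>j<N. A $$ (i, j) \<noteq> A $$ (k, j)"
proof -
  define p where "p = block_partition N A"
  have bc: "block_constant N A p" unfolding p_def by (rule block_partition_least)
  then have part: "partition_on {0..<N} p" unfolding block_constant_def by blast
  then have cover: "\<Union>p = {0..<N}" and disj: "\<And>I J. I \<in> p \<Longrightarrow> J \<in> p \<Longrightarrow> I \<inter> J \<noteq> {} \<Longrightarrow> I = J"
    and ne: "{} \<notin> p"
    unfolding partition_on_def disjoint_def by auto
  have Min_in: "Min I \<in> I" if "I \<in> p" for I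
  proof (rule Min_in)
    show "finite I" using cover that by (metis Union_upper finite_atLeastLessThan finite_subset)
    show "I \<noteq> {}" using ne that by auto
  qed
  define E where "E = {(i, k). i < N \<and> k < N \<and> (\<forall>j<N. A $$ (i, j) = A $$ (k, j))}"
  have eqE: "equiv {0..<N} E"
    by (rule equivI) (auto simp: E_def refl_on_def sym_def trans_def)
  have "block_constant N A ({0..<N} // E)"
    unfolding block_constant_def
  proof (intro conjI ballI partition_on_quotient[OF eqE])
    fix I J i i' j j' assume "I \<in> {0..<N} // E" "J \<in> {0..<N} // E" "i \<in> I" "i' \<in> I" "j \<in> J" "j' \<in> J"
    then have ii: "(i, i') \<in> E" and jj: "(j, j') \<in> E"
      using eqE by (meson in_quotient_imp_in_rel empty_subsetI insert_subset)+
    have "A $$ (i, j) = A $$ (i', j)" using ii jj unfolding E_def by blast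
    also have "\<dots> = cnj (A $$ (j, i'))" using ii jj herm[of j i'] unfolding E_def by blast
    also have "\<dots> = cnj (A $$ (j', i'))" using ii jj unfolding E_def by auto
    also have "\<dots> = A $$ (i', j')" using ii jj herm[of j' i'] unfolding E_def by auto
    finally show "A $$ (i, j) = A $$ (i', j')" .
  qed
  then have refine: "\<exists>Y\<in>p. X \<subseteq> Y" if "X \<in> {0..<N} // E" for X
    using block_partition_least(2) that unfolding p_def coarser_def refines_def by blast
  show ?thesis
  proof (rule that[of "Min ` p"])
    show "Min ` p \<subseteq> {0..<N}" using Min_in cover by auto
    have "inj_on Min p"
      by (rule inj_onI) (metis Min_in disj disjoint_iff)
    then show "card (Min ` p) = card (block_partition N A)" unfolding p_def by (rule card_image)
    show "\<exists>r\<in>Min ` p. \<forall>i<N. A $$ (i, j) = A $$ (i, r)" if j: "j < N" for j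
    proof -
      obtain J where J: "J \<in> p" "j \<in> J" using j cover by (metis UnionE atLeastLessThan_iff zero_le)
      have "A $$ (i, j) = A $$ (i, Min J)" if i: "i < N" for i
      proof -
        obtain I where "I \<in> p" "i \<in> I" using i cover by (metis UnionE atLeastLessThan_iff zero_le)
        then show ?thesis using bc J Min_in[OF J(1)] unfolding block_constant_def by blast
      qed
      then show ?thesis using J(1) by blast
    qed
    show "\<exists>j<N. A $$ (i, j) \<noteq> A $$ (k, j)" if ik: "i \<in> Min ` p" "k \<in> Min ` p" "i \<noteq> k" for i k
    proof (rule ccontr)
      assume eq: "\<not> ?thesis"
      obtain I K where I: "I \<in> p" "i = Min I" and K: "K \<in> p" "k = Min K" using ik by auto
      have iI: "i \<in> I" "k \<in> K" using Min_in I K by auto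
      then have "i < N" "k < N" using I(1) K(1) cover by auto
      then have "(i, k) \<in> E" "(i, i) \<in> E" using eq unfolding E_def by auto
      moreover have "E `` {i} \<in> {0..<N} // E" using \<open>i < N\<close> by (intro quotientI) simp
      ultimately obtain Y where "Y \<in> p" "i \<in> Y" "k \<in> Y" using refine by blast
      then have "I = Y" "K = Y" using disj I(1) K(1) iI by blast+
      then show False using ik(3) I(2) K(2) by simp
    qed
  qed
qed

text \<open>Polarization: the form is real at all vectors supported on two indices \<open>i\<close> and \<open>j\<close>, and the
  values at \<open>e\<^sub>i + t e\<^sub>j\<close> for \<open>t = 1\<close> and \<open>t = \<i>\<close> force \<open>a j i = cnj (a i j)\<close>.\<close>

lemma psd_imp_psd_on:
  assumes "psd N A"
  shows "psd_on {0..<N} (\<lambda>i j. A $$ (i, j))"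
proof -
  define a where "a = (\<lambda>i j. A $$ (i, j))"
  have A: "A \<in> carrier_mat N N" using assms unfolding psd_def by blast
  have q: "0 \<le> qform {0..<N} a v" for v
  proof -
    have "(A *\<^sub>v vec N v) \<bullet>c vec N v = qform {0..<N} a v"
      unfolding qform_def a_def using A
      by (simp add: scalar_prod_def sum_distrib_right sum_distrib_left mult.commute mult.left_commute)
    moreover have "0 \<le> (A *\<^sub>v vec N v) \<bullet>c vec N v" using assms unfolding psd_def by simp
    ultimately show ?thesis by simp
  qed
  have diag: "Im (a i i) = 0" if "i < N" for i
  proof -
    have "qform {i} a (\<lambda>_. 1) = a i i" by (simp add: qform_def)
    then show ?thesis using q[of "\<lambda>j. if j \<in> {i} then 1 else 0"] qform_restrict[of "{0..<N}" "{i}" a "\<lambda>_. 1"] that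
      by (simp add: less_eq_complex_def)
  qed
  have "psd_on {0..<N} a"
  proof (rule psd_onI)
    show "0 \<le> Re (qform {0..<N} a v)" for v using q[of v] by (simp add: less_eq_complex_def)
    fix i j assume ij: "i \<in> {0..<N}" "j \<in> {0..<N}"
    show "a j i = cnj (a i j)"
    proof (cases "i = j")
      case True
      then show ?thesis using diag ij by (simp add: complex_eq_iff)
    next
      case False
      have "Im (t * a i j + cnj t * a j i) = 0" for t
      proof -
        define v where "v = (\<lambda>k. if k = i then 1 else t)"
        have "qform {i, j} a v = a i i + t * a i j + cnj t * a j i + (cnj t * t) * a j j"
          unfolding qform_def v_def using False by (simp add: algebra_simps)
        moreover have "0 \<le> qform {i, j} a v"
          using q[of "\<lambda>k. if k \<in> {i, j} then v k else 0"] qform_restrict[of "{0..<N}" "{i, j}" a v] ij by simp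
        moreover have "Im (a i i) = 0" "Im (a j j) = 0" using diag ij by auto
        ultimately show ?thesis by (simp add: less_eq_complex_def)
      qed
      from this[of 1] this[of \<i>] show ?thesis by (simp add: complex_eq_iff)
    qed
  qed
  then show ?thesis unfolding a_def .
qed

section \<open>The critical constant through Vandermonde products\<close>

lemma vdm_snoc: "vdm (xs @ [x]) = vdm xs * (\<Prod>y\<leftarrow>xs. real x - real y)"
proof -
  have "(\<Prod>l<length xs. \<Prod>k<l. real ((xs @ [x]) ! l) - real ((xs @ [x]) ! k)) = vdm xs"
    unfolding vdm_def by (intro prod.cong refl) (auto simp: nth_append)
  moreover have "(\<Prod>k<length xs. real x - real ((xs @ [x]) ! k)) = (\<Prod>y\<leftarrow>xs. real x - real y)"
    by (simp add: prod.list_conv_set_nth nth_append atLeast0LessThan)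
  ultimately show ?thesis unfolding vdm_def by (simp add: nth_append)
qed

lemma vdm_insert:
  "vdm (xs @ a # ys) = vdm (xs @ ys) * ((\<Prod>x\<leftarrow>xs. real a - real x) * (\<Prod>y\<leftarrow>ys. real y - real a))"
proof (induction ys rule: rev_induct)
  case Nil
  show ?case by (simp add: vdm_snoc)
next
  case (snoc y ys)
  have "vdm (xs @ a # ys @ [y]) = vdm (xs @ a # ys) * (\<Prod>z\<leftarrow>xs @ a # ys. real y - real z)"
    using vdm_snoc[of "xs @ a # ys" y] by simp
  moreover have "vdm (xs @ ys @ [y]) = vdm (xs @ ys) * (\<Prod>z\<leftarrow>xs @ ys. real y - real z)"
    using vdm_snoc[of "xs @ ys" y] by simp
  ultimately show ?case using snoc.IH by simp
qed

lemma falling_product: "(\<Prod>i<k. real n - real i) = real (n choose k) * fact k"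
  by (simp add: binomial_gbinomial gbinomial_prod_rev atLeast0LessThan)

lemma prod_list_upt: "(\<Prod>k\<leftarrow>[a..<b]. g k) = (\<Prod>i<b - a. g (a + i) :: real)"
proof -
  have "(\<Prod>k\<leftarrow>[a..<b]. g k) = prod g {a..<b}"
    using prod.distinct_set_conv_list[of "[a..<b]" g] by simp
  also have "\<dots> = (\<Prod>i<b - a. g (a + i))"
    by (rule prod.reindex_bij_witness[of _ "\<lambda>i. a + i" "\<lambda>k. k - a"]) auto
  finally show ?thesis .
qed

text \<open>Deleting \<open>n\<^sub>j\<close> from the Vandermonde product removes the factors \<open>j!\<close> and \<open>(N - 1 - j)!\<close>, and
  appending \<open>M\<close> adds the differences \<open>M - n\<^sub>k\<close> for \<open>k \<noteq> j\<close>, which form two falling factorials.\<close>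

lemma vdm_ratio:
  assumes n: "\<And>j. j < N \<Longrightarrow> n j = n 0 + j" and M: "n (N - 1) < M" and j: "j < N"
  shows "vdm (exps_omit N n M j) / vdm (exps N n) = hook_dim N (M - n 0) j"
proof -
  define m0 where "m0 = n 0"
  have n0: "n i = m0 + i" if "i < N" for i using n[OF that] unfolding m0_def .
  define m where "m = N - 1 - j"
  have N: "N = Suc j + m" using j unfolding m_def by simp
  define M0 where "M0 = M - m0"
  have M0: "M = m0 + M0" "j + m < M0" using M n0[of "N - 1"] j N unfolding M0_def by auto
  define xs ys where "xs = map n [0..<j]" and "ys = map n [Suc j..<N]"
  have split: "exps N n = xs @ n j # ys"
    unfolding exps_def xs_def ys_def using upt_add_eq_append[of 0 j "N - j"] j
    by (simp add: upt_conv_Cons)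
  have omit: "exps_omit N n M j = (xs @ ys) @ [M]"
    unfolding exps_omit_def xs_def ys_def by simp
  have "(\<Prod>x\<leftarrow>xs. real (n j) - real x) = (\<Prod>i<j. real j - real i)"
    unfolding xs_def map_map prod_list_upt o_def using n0 j by (intro prod.cong) auto
  then have 1: "(\<Prod>x\<leftarrow>xs. real (n j) - real x) = fact j" by (simp add: falling_product)
  have "(\<Prod>y\<leftarrow>ys. real y - real (n j)) = (\<Prod>i<m. real (Suc i))"
    unfolding ys_def map_map prod_list_upt o_def using n0 N j by (intro prod.cong) auto
  then have 2: "(\<Prod>y\<leftarrow>ys. real y - real (n j)) = fact m"
    by (simp add: fact_prod_Suc atLeast0LessThan)
  have "(\<Prod>x\<leftarrow>xs. real M - real x) = (\<Prod>i<j. real M0 - real i)"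
    unfolding xs_def map_map prod_list_upt o_def using n0 j M0 by (intro prod.cong) auto
  then have 3: "(\<Prod>x\<leftarrow>xs. real M - real x) = real (M0 choose j) * fact j" by (simp add: falling_product)
  have "(\<Prod>y\<leftarrow>ys. real M - real y) = (\<Prod>i<m. real (M0 - 1 - j) - real i)"
    unfolding ys_def map_map prod_list_upt o_def using n0 N j M0 by (intro prod.cong) (auto simp: of_nat_diff)
  then have 4: "(\<Prod>y\<leftarrow>ys. real M - real y) = real (M0 - 1 - j choose m) * fact m" by (simp only: falling_product)
  have "vdm (exps N n) \<noteq> 0"
    unfolding vdm_def exps_def using n0 by auto
  then have "vdm (xs @ ys) \<noteq> 0" unfolding split vdm_insert by auto
  moreover have "vdm (exps_omit N n M j) = vdm (xs @ ys) * (fact j * fact m * hook_dim N M0 j)"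
    unfolding omit vdm_snoc by (simp add: 3 4 hook_dim_def m_def)
  moreover have "vdm (exps N n) = vdm (xs @ ys) * (fact j * fact m)"
    unfolding split vdm_insert 1 2 ..
  ultimately show ?thesis unfolding M0_def m0_def by simp
qed

lemma crit_const_eq_crit:
  assumes n: "\<And>j. j < N \<Longrightarrow> n j = n 0 + j" and M: "n (N - 1) < M"
  shows "crit_const N \<rho> n M c = crit \<rho> N (M - n 0) c"
  unfolding crit_const_def crit_def
proof (intro sum.cong refl)
  fix j assume "j \<in> {..<N}"
  then have j: "j < N" by simp
  have "(vdm (exps_omit N n M j))\<^sup>2 / (vdm (exps N n))\<^sup>2 = (hook_dim N (M - n 0) j)\<^sup>2"
    using vdm_ratio[where n = n, OF n M j] by (metis power_divide)
  then show "(vdm (exps_omit N n M j))\<^sup>2 / (vdm (exps N n))\<^sup>2 * (\<rho> ^ (M - n j) / c j)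
      = (hook_dim N (M - n 0) j)\<^sup>2 * (\<rho> ^ (M - n 0 - j) / c j)"
    using n[OF j] by simp
qed

section \<open>The rank of an entrywise image\<close>

text \<open>Columns of indices in the same block have equal images, and on representatives of the blocks
  the form of \<open>f[A]\<close> is definite by \<open>perturbed_definite\<close>, so that the images of their columns
  are independent. Two representatives have rows that differ, and that difference is visible in
  a column indexed by a representative.\<close>

lemma rank_entrywise_eq_card_blocks:
  fixes A :: "complex mat"
  assumes N: "N \<ge> 2" and \<rho>: "\<rho> > 0"
    and n: "\<And>j. j < N \<Longrightarrow> n j = n 0 + j" and M: "n (N - 1) < M"
    and c: "\<And>j. j < N \<Longrightarrow> c j > 0" and c': "c' \<ge> - inverse (crit_const N \<rho> n M c)"
    and f: "\<And>z. f z = (\<Sum>j<N. complex_of_real (c j) * z ^ n j) + complex_of_real c' * z ^ M"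
    and A: "A \<in> psd_disc N \<rho>" and zero_row: "(\<exists>i<N. row A i = 0\<^sub>v N) \<Longrightarrow> n 0 = 0"
  shows "vec_space.rank N (entrywise f A) = card (block_partition N A)"
proof -
  define a where "a = (\<lambda>i j. A $$ (i, j))"
  define m where "m = n 0"
  have n_eq: "n l = m + l" if "l < N" for l using n[OF that] unfolding m_def .
  define M0 where "M0 = M - m"
  have M0: "M = m + M0" "N \<le> M0" using M n_eq[of "N - 1"] N unfolding M0_def by auto
  have crit_eq: "crit_const N \<rho> n M c = crit \<rho> N (M - n 0) c"
    by (rule crit_const_eq_crit[OF n M])
  have psdA: "psd N A" and entries: "\<And>i j. i < N \<Longrightarrow> j < N \<Longrightarrow> cmod (a i j) \<le> \<rho>"
    using A unfolding psd_disc_def a_def by auto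
  have carrier: "A \<in> carrier_mat N N" using psdA unfolding psd_def by blast
  have psd: "psd_on {0..<N} a" unfolding a_def by (rule psd_imp_psd_on) fact
  have herm: "A $$ (j, i) = cnj (A $$ (i, j))" if "i < N" "j < N" for i j
    using psd_on_hermitian[OF psd, of i j] that unfolding a_def by simp
  obtain R where R: "R \<subseteq> {0..<N}" "card R = card (block_partition N A)"
    and rep: "\<And>j. j < N \<Longrightarrow> \<exists>r\<in>R. \<forall>i<N. A $$ (i, j) = A $$ (i, r)"
    and distinct: "\<And>i k. i \<in> R \<Longrightarrow> k \<in> R \<Longrightarrow> i \<noteq> k \<Longrightarrow> \<exists>j<N. A $$ (i, j) \<noteq> A $$ (k, j)"
    by (rule block_representatives[OF herm]) (assumption | rule that)+
  have RN: "i < N" if "i \<in> R" for i using R(1) that by auto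
  have fin: "finite R" using R(1) finite_subset by blast
  have ne: "R \<noteq> {}" using rep[of 0] N by auto
  have card: "card R \<le> N" using card_mono[OF _ R(1)] by simp
  have f_eq: "f (a i j) = (\<Sum>l<N. of_real (c l) * a i j ^ (m + l)) + of_real c' * a i j ^ (m + M0)" for i j
    unfolding f M0(1)[symmetric] using n_eq by (intro arg_cong2[where f = "(+)"] sum.cong refl) auto
  show ?thesis
    unfolding R(2)[symmetric]
  proof (rule rank_eq_card_representatives[OF _ R(1)])
    show "entrywise f A \<in> carrier_mat N N" using carrier unfolding entrywise_def by simp
    show "\<exists>r\<in>R. col (entrywise f A) j = col (entrywise f A) r" if j: "j < N" for j
    proof -
      obtain r where r: "r \<in> R" "\<forall>i<N. A $$ (i, j) = A $$ (i, r)" using rep[OF j] by blast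
      then have "col (entrywise f A) j = col (entrywise f A) r"
        using carrier j RN[OF r(1)] unfolding entrywise_def by (intro eq_vecI) auto
      then show ?thesis using r(1) by blast
    qed
  next
    fix v :: "nat \<Rightarrow> complex" and k
    assume v: "\<And>i. i \<in> R \<Longrightarrow> (\<Sum>j\<in>R. entrywise f A $$ (i, j) * v j) = 0" and k: "k \<in> R"
    have "(\<Sum>j\<in>R. f (a i j) * v j) = 0" if "i \<in> R" for i
      using v[OF that] RN that carrier unfolding entrywise_def a_def by (simp cong: sum.cong)
    then have "qform R (\<lambda>i j. f (a i j)) v = 0"
      unfolding qform_def by (simp add: mult.assoc flip: sum_distrib_left)
    then have q: "Re (qform R (\<lambda>i j. (\<Sum>l<N. of_real (c l) * a i j ^ (m + l)) + of_real c' * a i j ^ (m + M0)) v) \<le> 0"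
      unfolding f_eq by simp
    show "v k = 0"
    proof (rule perturbed_definite[OF fin ne card N M0(2) \<rho> _ _ _ _ c _ q k])
      show "psd_on R a" using psd_on_subset[OF psd _ R(1)] by simp
      show "Re (a i i) \<le> \<rho>" if "i \<in> R" for i
        using entries[OF RN[OF that] RN[OF that]] complex_Re_le_cmod order_trans by blast
      show "\<exists>j\<in>R. a i j \<noteq> a k j" if "i \<in> R" "k \<in> R" "i \<noteq> k" for i k
        using distinct[OF that] rep RN that unfolding a_def by metis
      show "m = 0 \<or> (\<exists>j\<in>R. a i j \<noteq> 0)" if i: "i \<in> R" for i
      proof (rule disjCI)
        assume "\<not> (\<exists>j\<in>R. a i j \<noteq> 0)"
        then have "A $$ (i, j) = 0" if "j < N" for j
          using rep[OF that] RN[OF i] unfolding a_def by auto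
        then have "row A i = 0\<^sub>v N" using carrier RN[OF i] by (intro eq_vecI) auto
        then show "m = 0" unfolding m_def using zero_row RN[OF i] by blast
      qed
      show "- inverse (crit \<rho> N M0 c) \<le> c'"
        using c' unfolding crit_eq M0_def m_def .
    qed
  qed
qed

theorem theorem3p3:
  fixes N M :: nat and \<rho> c' :: real and n :: "nat \<Rightarrow> nat" and c :: "nat \<Rightarrow> real"
    and f g h :: "complex \<Rightarrow> complex" and A :: "complex mat"
  assumes "N \<ge> 2" and "\<rho> > 0"
    and "\<And>j. j < N \<Longrightarrow> n j = n 0 + j" and "n (N - 1) < M"
    and "\<And>j. j < N \<Longrightarrow> c j > 0"
    and "c' > - inverse (crit_const N \<rho> n M c)"
    and "\<And>z. h z = (\<Sum>j<N. complex_of_real (c j) * z ^ n j)"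
    and "\<And>z. f z = h z + complex_of_real c' * z ^ M"
    and "\<And>z. g z = h z - complex_of_real (inverse (crit_const N \<rho> n M c)) * z ^ M"
    and "A \<in> psd_disc N \<rho>"
    and "(\<exists>i<N. row A i = 0\<^sub>v N) \<Longrightarrow> n 0 = 0"
  shows "vec_space.rank N (entrywise f A) = vec_space.rank N (entrywise h A)
    \<and> vec_space.rank N (entrywise h A) = card (block_partition N A)
    \<and> (A \<notin> stratum N (finest N)
         \<or> (A \<in> stratum N (finest N)
            \<and> (\<exists>i<N. inj_on (\<lambda>j. A $$ (i, j)) {0..<N}
                 \<and> ((\<exists>j<N. A $$ (i, j) = 0) \<longrightarrow> n 0 = 0)))
       \<longrightarrow> vec_space.rank N (entrywise g A) = card (block_partition N A))"
proof -
  have "crit_const N \<rho> n M c = crit \<rho> N (M - n 0) c"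
    by (rule crit_const_eq_crit[OF assms(3,4)])
  also have "\<dots> > 0"
    using assms(1,2,5) assms(3)[of "N - 1"] assms(4) by (intro crit_pos) auto
  finally have zero: "0 \<ge> - inverse (crit_const N \<rho> n M c)" by simp
  have rank: "vec_space.rank N (entrywise F A) = card (block_partition N A)"
    if "t \<ge> - inverse (crit_const N \<rho> n M c)" "\<And>z. F z = h z + complex_of_real t * z ^ M" for F t
    by (rule rank_entrywise_eq_card_blocks[where n = n and c = c and c' = t, OF assms(1-5) that(1) _ assms(10,11)])
      (assumption | simp only: that(2) assms(7))+
  have "vec_space.rank N (entrywise f A) = card (block_partition N A)"
    by (rule rank[of c']) (use assms(6,8) in auto)
  moreover have "vec_space.rank N (entrywise h A) = card (block_partition N A)"
    by (rule rank[of 0]) (use zero in auto)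
  moreover have "vec_space.rank N (entrywise g A) = card (block_partition N A)"
    by (rule rank[of "- inverse (crit_const N \<rho> n M c)"]) (use assms(9) in auto)
  ultimately show ?thesis by simp
qed

end
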